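(* Let $(X,\varphi)$ be a minimal subshift with $X$ a Cantor set. Then $D([[\varphi]]_0)$ is not finitely presented.
   Context: A subshift is a closed shift-invariant subset $X$ of $A^{\mathbb{Z}}$ ($A$ a finite set, product topology) together with the restriction $\varphi$ of the two-sided shift; it is minimal if the only closed $\varphi$-invariant subsets of $X$ are $\emptyset$ and $X$. The topological full group $[[\varphi]]$ is the group of all homeomorphisms $\gamma$ of $X$ for which there is a continuous map $n_\gamma:X\to\mathbb{Z}$ with $\gamma(x)=\varphi^{n_\gamma(x)}(x)$ for all $x\in X$. The index map $I:[[\varphi]]\to\mathbb{Z}$ is $I(\gamma)=\int n_\gamma\,d\mu$, where $\mu$ is a $\varphi$-invariant probability measure; it is known that $I(\gamma)$ is an integer independent of $\mu$ and that $I$ is a surjective homomorphism. $[[\varphi]]_0$ is the kernel of $I$. For a group $H$, $D(H)$ is its commutator subgroup. *)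

theory Defs
  imports
    "HOL-Probability.Probability_Measure"
    "HOL-Algebra.Bij"
    "HOL-Algebra.Generated_Groups"
begin

section \<open>Subshifts\<close>

definition full_shift :: "'a set \<Rightarrow> (int \<Rightarrow> 'a) topology" where
  "full_shift A = product_topology (\<lambda>_. discrete_topology A) UNIV"

definition seq_shift :: "(int \<Rightarrow> 'a) \<Rightarrow> (int \<Rightarrow> 'a)" where
  "seq_shift x = (\<lambda>i. x (i + 1))"

text \<open>The integer powers of the shift; the lemmas below pin the closed form down.\<close>

definition seq_shift_pow :: "int \<Rightarrow> (int \<Rightarrow> 'a) \<Rightarrow> (int \<Rightarrow> 'a)" where
  "seq_shift_pow n x = (\<lambda>i. x (i + n))"

lemma seq_shift_pow_of_nat: "seq_shift_pow (int n) = seq_shift ^^ n"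
proof (induction n)
  case (Suc n)
  have "seq_shift_pow (int (Suc n)) x = seq_shift (seq_shift_pow (int n) x)" for x :: "int \<Rightarrow> 'a"
    by (simp add: seq_shift_pow_def seq_shift_def algebra_simps)
  with Suc show ?case by auto
qed (auto simp: seq_shift_pow_def)

lemma seq_shift_pow_uminus: "seq_shift_pow (- n) = inv_into UNIV (seq_shift_pow n)"
  by (rule Hilbert_Choice.inv_equality[symmetric]) (simp_all add: seq_shift_pow_def)

definition subshift :: "'a set \<Rightarrow> (int \<Rightarrow> 'a) set \<Rightarrow> bool" where
  "subshift A X \<longleftrightarrow> closedin (full_shift A) X \<and> seq_shift ` X = X"

abbreviation subshift_topology :: "'a set \<Rightarrow> (int \<Rightarrow> 'a) set \<Rightarrow> (int \<Rightarrow> 'a) topology" where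
  "subshift_topology A X \<equiv> subtopology (full_shift A) X"

definition minimal_subshift :: "'a set \<Rightarrow> (int \<Rightarrow> 'a) set \<Rightarrow> bool" where
  "minimal_subshift A X \<longleftrightarrow> subshift A X \<and>
    (\<forall>Y. closedin (subshift_topology A X) Y \<and> seq_shift ` Y = Y \<longrightarrow> Y = {} \<or> Y = X)"

definition cantor_set :: "'x topology \<Rightarrow> bool" where
  "cantor_set T \<longleftrightarrow>
    T homeomorphic_space product_topology (\<lambda>_::nat. discrete_topology (UNIV :: bool set)) UNIV"


section \<open>The topological full group and the index map\<close>

definition is_cocycle ::
  "'a set \<Rightarrow> (int \<Rightarrow> 'a) set \<Rightarrow> ((int \<Rightarrow> 'a) \<Rightarrow> (int \<Rightarrow> 'a)) \<Rightarrow> ((int \<Rightarrow> 'a) \<Rightarrow> int) \<Rightarrow> bool" where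
  "is_cocycle A X \<gamma> n \<longleftrightarrow>
    continuous_map (subshift_topology A X) (discrete_topology UNIV) n \<and>
    (\<forall>x\<in>X. \<gamma> x = seq_shift_pow (n x) x)"

text \<open>A homeomorphism of \<open>X\<close> is represented by the function that is \<open>undefined\<close> outside \<open>X\<close>,
  so that equality of group elements is equality of maps on \<open>X\<close>.\<close>

definition full_group ::
  "'a set \<Rightarrow> (int \<Rightarrow> 'a) set \<Rightarrow> ((int \<Rightarrow> 'a) \<Rightarrow> (int \<Rightarrow> 'a)) monoid" where
  "full_group A X = (BijGroup X) \<lparr>carrier :=
    {\<gamma> \<in> extensional X.
      homeomorphic_map (subshift_topology A X) (subshift_topology A X) \<gamma> \<and>
      (\<exists>n. is_cocycle A X \<gamma> n)}\<rparr>"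

definition invariant_prob :: "'a set \<Rightarrow> (int \<Rightarrow> 'a) set \<Rightarrow> (int \<Rightarrow> 'a) measure \<Rightarrow> bool" where
  "invariant_prob A X \<mu> \<longleftrightarrow> prob_space \<mu> \<and>
    sets \<mu> = sets (sigma X {U. openin (subshift_topology A X) U}) \<and>
    (\<forall>B\<in>sets \<mu>. emeasure \<mu> (seq_shift -` B \<inter> X) = emeasure \<mu> B)"

text \<open>For an infinite minimal \<open>X\<close> there are no periodic points, so the cocycle of \<open>\<gamma>\<close> is unique
  on \<open>X\<close>; an invariant probability measure exists, and the integral does not depend on its choice.
  The value is an integer, but is taken in the type of the integral.\<close>

definition index_map :: "'a set \<Rightarrow> (int \<Rightarrow> 'a) set \<Rightarrow> ((int \<Rightarrow> 'a) \<Rightarrow> (int \<Rightarrow> 'a)) \<Rightarrow> real" where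
  "index_map A X \<gamma> =
    (\<integral>x. real_of_int ((SOME n. is_cocycle A X \<gamma> n) x) \<partial>(SOME \<mu>. invariant_prob A X \<mu>))"

definition full_group_0 ::
  "'a set \<Rightarrow> (int \<Rightarrow> 'a) set \<Rightarrow> ((int \<Rightarrow> 'a) \<Rightarrow> (int \<Rightarrow> 'a)) monoid" where
  "full_group_0 A X =
    (full_group A X) \<lparr>carrier := {\<gamma> \<in> carrier (full_group A X). index_map A X \<gamma> = 0}\<rparr>"


section \<open>Commutator subgroups and finite presentations\<close>

definition commutator_subgroup :: "('g, 'm) monoid_scheme \<Rightarrow> ('g, 'm) monoid_scheme" where
  "commutator_subgroup H = H \<lparr>carrier := derived H (carrier H)\<rparr>"

text \<open>The free group on \<open>S\<close>: words in the letters \<open>(s, True)\<close> and \<open>(s, False)\<close>, standing for \<open>s\<close>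
  and its inverse, modulo insertion and deletion of mutually inverse neighbours.\<close>

abbreviation fg_words :: "'s set \<Rightarrow> ('s \<times> bool) list set" where
  "fg_words S \<equiv> lists (S \<times> UNIV)"

inductive_set fg_eq :: "'s set \<Rightarrow> (('s \<times> bool) list \<times> ('s \<times> bool) list) set"
  for S :: "'s set" where
  refl: "w \<in> fg_words S \<Longrightarrow> (w, w) \<in> fg_eq S"
| sym: "(u, v) \<in> fg_eq S \<Longrightarrow> (v, u) \<in> fg_eq S"
| trans: "(u, v) \<in> fg_eq S \<Longrightarrow> (v, w) \<in> fg_eq S \<Longrightarrow> (u, w) \<in> fg_eq S"
| cancel: "u \<in> fg_words S \<Longrightarrow> v \<in> fg_words S \<Longrightarrow> s \<in> S \<Longrightarrow>
    (u @ [(s, b), (s, \<not> b)] @ v, u @ v) \<in> fg_eq S"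

definition free_group :: "'s set \<Rightarrow> ('s \<times> bool) list set monoid" where
  "free_group S = \<lparr>
    carrier = fg_words S // fg_eq S,
    mult = (\<lambda>U V. \<Union>u\<in>U. \<Union>v\<in>V. fg_eq S `` {u @ v}),
    one = fg_eq S `` {[]}\<rparr>"

definition normal_closure :: "('g, 'm) monoid_scheme \<Rightarrow> 'g set \<Rightarrow> 'g set" where
  "normal_closure G R =
    generate G {g \<otimes>\<^bsub>G\<^esub> r \<otimes>\<^bsub>G\<^esub> inv\<^bsub>G\<^esub> g | g r. g \<in> carrier G \<and> r \<in> R}"

definition finitely_presented :: "('g, 'm) monoid_scheme \<Rightarrow> bool" where
  "finitely_presented G \<longleftrightarrow>
    (\<exists>(S :: nat set) R. finite S \<and> finite R \<and> R \<subseteq> carrier (free_group S) \<and>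
      G \<cong> free_group S Mod normal_closure (free_group S) R)"

lemma fg_eq_words: "(u, v) \<in> fg_eq S \<Longrightarrow> u \<in> fg_words S \<and> v \<in> fg_words S"
  by (induction rule: fg_eq.induct) auto

lemma equiv_fg_eq: "equiv (fg_words S) (fg_eq S)"
  by (rule equivI)
    (auto simp: refl_on_def sym_def trans_def intro: fg_eq.intros dest: fg_eq_words)

lemma fg_eq_append:
  assumes "(u, u') \<in> fg_eq S" "(v, v') \<in> fg_eq S"
  shows "(u @ v, u' @ v') \<in> fg_eq S"
proof -
  have 1: "(u @ w, u' @ w) \<in> fg_eq S" if "w \<in> fg_words S" for w
    using assms(1)
  proof (induction rule: fg_eq.induct)
    case (cancel u v s b)
    then show ?case using fg_eq.cancel[of u S "v @ w" s b] that by simp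
  next
    case (refl u)
    then show ?case using that by (intro fg_eq.refl) simp
  qed (blast intro: fg_eq.sym fg_eq.trans)+
  have 2: "(w @ v, w @ v') \<in> fg_eq S" if "w \<in> fg_words S" for w
    using assms(2)
  proof (induction rule: fg_eq.induct)
    case (cancel u v s b)
    then show ?case using fg_eq.cancel[of "w @ u" S v s b] that by simp
  next
    case (refl u)
    then show ?case using that by (intro fg_eq.refl) simp
  qed (blast intro: fg_eq.sym fg_eq.trans)+
  show ?thesis
    using 1[of v] 2[of u'] fg_eq_words[OF assms(1)] fg_eq_words[OF assms(2)]
    by (blast intro: fg_eq.trans)
qed

lemma free_group_mult:
  assumes "u \<in> fg_words S" "v \<in> fg_words S"
  shows "fg_eq S `` {u} \<otimes>\<^bsub>free_group S\<^esub> fg_eq S `` {v} = fg_eq S `` {u @ v}"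
proof -
  have "congruent2 (fg_eq S) (fg_eq S) (\<lambda>u v. fg_eq S `` {u @ v})"
    by (rule congruent2I'[where ?r1.0="fg_eq S"])
      (auto intro!: equiv_class_eq[OF equiv_fg_eq] fg_eq_append)
  from UN_equiv_class2[OF equiv_fg_eq equiv_fg_eq this assms] show ?thesis
    by (simp add: free_group_def)
qed

lemma fg_eq_inverse:
  "w \<in> fg_words S \<Longrightarrow> (rev (map (\<lambda>(s, b). (s, \<not> b)) w) @ w, []) \<in> fg_eq S"
proof (induction w)
  case Nil
  then show ?case by (auto intro: fg_eq.refl)
next
  case (Cons x w)
  obtain s b where x: "x = (s, b)" by force
  let ?i = "rev (map (\<lambda>(s, b). (s, \<not> b)) w)"
  have "?i \<in> fg_words S" "s \<in> S" "w \<in> fg_words S"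
    using Cons.prems x by (auto simp: in_lists_conv_set)
  then have "(?i @ [(s, \<not> b), (s, \<not> \<not> b)] @ w, ?i @ w) \<in> fg_eq S"
    by (intro fg_eq.cancel)
  then show ?case using Cons x by (auto intro: fg_eq.trans)
qed

lemma group_free_group: "group (free_group S)"
proof (rule groupI)
  fix U V assume "U \<in> carrier (free_group S)" "V \<in> carrier (free_group S)"
  then obtain u v where "u \<in> fg_words S" "v \<in> fg_words S"
    "U = fg_eq S `` {u}" "V = fg_eq S `` {v}"
    by (auto simp: free_group_def elim!: quotientE)
  moreover from this have "fg_eq S `` {u @ v} \<in> carrier (free_group S)"
    by (auto simp: free_group_def intro!: quotientI)
  ultimately show "U \<otimes>\<^bsub>free_group S\<^esub> V \<in> carrier (free_group S)"
    by (simp add: free_group_mult)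
next
  show "\<one>\<^bsub>free_group S\<^esub> \<in> carrier (free_group S)"
    by (auto simp: free_group_def intro: quotientI)
next
  fix U V W
  assume "U \<in> carrier (free_group S)" "V \<in> carrier (free_group S)" "W \<in> carrier (free_group S)"
  then obtain u v w where "u \<in> fg_words S" "v \<in> fg_words S" "w \<in> fg_words S"
    "U = fg_eq S `` {u}" "V = fg_eq S `` {v}" "W = fg_eq S `` {w}"
    by (auto simp: free_group_def elim!: quotientE)
  then show "U \<otimes>\<^bsub>free_group S\<^esub> V \<otimes>\<^bsub>free_group S\<^esub> W =
    U \<otimes>\<^bsub>free_group S\<^esub> (V \<otimes>\<^bsub>free_group S\<^esub> W)"
    by (simp add: free_group_mult)
next
  fix U assume "U \<in> carrier (free_group S)"
  then obtain u where u: "u \<in> fg_words S" "U = fg_eq S `` {u}"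
    by (auto simp: free_group_def elim!: quotientE)
  have one: "\<one>\<^bsub>free_group S\<^esub> = fg_eq S `` {[]}" by (simp add: free_group_def)
  show "\<one>\<^bsub>free_group S\<^esub> \<otimes>\<^bsub>free_group S\<^esub> U = U"
    using free_group_mult[of "[]" S u] u by (simp add: one)
  let ?i = "rev (map (\<lambda>(s, b). (s, \<not> b)) u)"
  have i: "?i \<in> fg_words S" using u by (auto simp: in_lists_conv_set)
  show "\<exists>V\<in>carrier (free_group S). V \<otimes>\<^bsub>free_group S\<^esub> U = \<one>\<^bsub>free_group S\<^esub>"
  proof
    show "fg_eq S `` {?i} \<in> carrier (free_group S)"
      using i by (auto simp: free_group_def intro: quotientI)
    show "fg_eq S `` {?i} \<otimes>\<^bsub>free_group S\<^esub> U = \<one>\<^bsub>free_group S\<^esub>"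
      using free_group_mult[OF i u(1)] equiv_class_eq[OF equiv_fg_eq fg_eq_inverse[OF u(1)]] u(2)
      by (simp add: one)
  qed
qed

end

theory Submission
  imports Defs "HOL-Combinatorics.Transposition"
begin

text \<open>
  Two properties of \<open>G = D([[\<phi>]]\<^sub>0)\<close> contradict finite presentability.  First, finite quotients do not
  separate its points: every point has a small clopen neighbourhood \<open>V\<close> with \<open>N + 1\<close> disjoint
  translates \<open>V, \<phi>V, \<dots>, \<phi>\<^sup>N V\<close>, so the 3-cycle on \<open>V, \<phi>V, \<phi>\<^sup>2V\<close> lies in an alternating group on
  \<open>N + 1\<close> letters inside \<open>G\<close>.  For large \<open>N\<close> a given finite quotient kills it, and a 3-cycle on
  \<open>W, \<phi>W, \<phi>\<^sup>2W\<close> is a finite product of such small ones.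

  Second, if \<open>G\<close> had finitely many generators and relators, all their cocycles would only look at a
  window of some bounded size.  By the pigeonhole principle there is a periodic sequence all of whose
  windows of that size occur in \<open>X\<close>.  The generators then act on its finite orbit by the same local
  rules, the relators act trivially, and \<open>G\<close> acts on a finite set.  The window of the periodic
  sequence at \<open>0\<close> determines a cylinder \<open>W\<close> whose 3-cycle acts non-trivially, a contradiction.

  The index map is a homomorphism because an invariant measure exists, which is obtained from
  empirical measures by Caratheodory's extension theorem.
\<close>

section \<open>Windows and compactness\<close>

text \<open>The cylinder on which the contradiction takes place is read off the periodic sequence,
  that sequence depends on the window size \<open>L\<close>, and \<open>L\<close> must suit the word
  that represents the 3-cycle over the cylinder. The circle is broken by fixing a cylinder size
  \<open>k0\<close> beforehand: there are finitely many cylinders of that size, the 3-cycle over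
  each is given by a word, and \<open>L\<close> is chosen for all these words and the relators at
  once. Displacements are compared between \<open>X\<close> and the periodic orbit, not maps. A word
  that fixes a point of \<open>X\<close> has displacement 0 there because \<open>X\<close> has no
  periodic points; on the periodic orbit, where nonzero shifts do fix points, the same conclusion is
  only available by transfer from \<open>X\<close>. The invariant measure serves to place 3-cycles
  in the commutator subgroup. The index is additive with real values, so involutions have index 0;
  transpositions of levels therefore lie in the kernel, and a 3-cycle is a commutator of two of
  them.\<close>

abbreviation sh :: "int \<Rightarrow> (int \<Rightarrow> 'a) \<Rightarrow> (int \<Rightarrow> 'a)" where
  "sh \<equiv> seq_shift_pow"

lemma sh_sh [simp]: "sh a (sh b x) = sh (a + b) x"
  by (simp add: seq_shift_pow_def add.assoc)

lemma sh_0 [simp]: "sh 0 x = x"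
  by (simp add: seq_shift_pow_def)

lemma seq_shift_eq_sh: "seq_shift = sh 1"
  by (simp add: seq_shift_pow_def seq_shift_def fun_eq_iff)

lemma sh_eq_iff: "sh a x = sh b y \<longleftrightarrow> x = sh (b - a) y"
proof
  assume "sh a x = sh b y"
  then have "sh (-a) (sh a x) = sh (-a) (sh b y)" by simp
  then show "x = sh (b - a) y" by simp
qed simp

text \<open>For fixed \<open>K\<close> this is an equivalence relation; its classes are the
  cylinders over the central window of length 2K+1, a basis of the topology as \<open>K\<close>
  varies.\<close>

definition agree :: "nat \<Rightarrow> (int \<Rightarrow> 'a) \<Rightarrow> (int \<Rightarrow> 'a) \<Rightarrow> bool" where
  "agree K x y \<longleftrightarrow> (\<forall>i. \<bar>i\<bar> \<le> int K \<longrightarrow> x i = y i)"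

lemma agree_refl [simp]: "agree K x x"
  by (simp add: agree_def)

lemma agree_sym: "agree K x y \<Longrightarrow> agree K y x"
  by (simp add: agree_def)

lemma agree_trans: "agree K x y \<Longrightarrow> agree K y z \<Longrightarrow> agree K x z"
  by (simp add: agree_def)

lemma agree_mono: "agree K x y \<Longrightarrow> L \<le> K \<Longrightarrow> agree L x y"
  by (simp add: agree_def)

lemma agree_sh: "agree K x y \<Longrightarrow> L + nat \<bar>n\<bar> \<le> K \<Longrightarrow> agree L (sh n x) (sh n y)"
  by (simp add: agree_def seq_shift_pow_def)

text \<open>Continuity into a discrete space, with the window made uniform by compactness: see
  \<open>continuous_imp_local\<close> and \<open>local_imp_continuous\<close>.\<close>

definition local_on :: "(int \<Rightarrow> 'a) set \<Rightarrow> nat \<Rightarrow> ((int \<Rightarrow> 'a) \<Rightarrow> 'b) \<Rightarrow> bool" where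
  "local_on X K f \<longleftrightarrow> (\<forall>x\<in>X. \<forall>y\<in>X. agree K x y \<longrightarrow> f x = f y)"

lemma local_onD: "local_on X K f \<Longrightarrow> x \<in> X \<Longrightarrow> y \<in> X \<Longrightarrow> agree K x y \<Longrightarrow> f x = f y"
  unfolding local_on_def by blast

lemma local_on_mono: "local_on X K f \<Longrightarrow> K \<le> L \<Longrightarrow> local_on X L f"
  unfolding local_on_def by (blast intro: agree_mono)

locale finite_subshift =
  fixes A :: "'a set" and X :: "(int \<Rightarrow> 'a) set"
  assumes finite_alphabet: "finite A"
    and subshift: "subshift A X"
begin

abbreviation T :: "(int \<Rightarrow> 'a) topology" where "T \<equiv> subshift_topology A X"

lemma X_subset: "X \<subseteq> topspace (full_shift A)"
  using subshift closedin_subset by (auto simp: subshift_def)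

lemma topspace_full: "topspace (full_shift A) = {x. range x \<subseteq> A}"
  by (auto simp: full_shift_def PiE_def extensional_def)

lemma X_in_A: "x \<in> X \<Longrightarrow> x i \<in> A"
  using X_subset topspace_full by auto

lemma topspace_T [simp]: "topspace T = X"
  using X_subset by (simp add: topspace_subtopology inf.absorb2)

lemma topspace_full_Int [simp]: "topspace (full_shift A) \<inter> X = X"
  using X_subset by blast

lemma compact_T: "compact_space T"
proof -
  have "compact_space (full_shift A)"
    unfolding full_shift_def
    by (simp add: compact_space_product_topology compact_space_discrete_topology finite_alphabet)
  then show ?thesis
    using subshift by (simp add: subshift_def closedin_compact_space compact_space_subtopology)
qed

lemma Hausdorff_T: "Hausdorff_space T"
  unfolding full_shift_def
  by (intro Hausdorff_space_subtopology) (simp add: Hausdorff_space_product_topology)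

text \<open>A basic open set of the product constrains finitely many coordinates, and a large enough
  central window contains them all; conversely a window is a finite constraint.\<close>

lemma openin_full:
  "openin (full_shift A) U \<longleftrightarrow>
    U \<subseteq> topspace (full_shift A) \<and>
    (\<forall>x\<in>U. \<exists>K. \<forall>y\<in>topspace (full_shift A). agree K x y \<longrightarrow> y \<in> U)" (is "?l \<longleftrightarrow> ?r")
proof
  assume l: ?l
  show ?r
  proof (intro conjI ballI)
    show "U \<subseteq> topspace (full_shift A)" using l by (rule openin_subset)
    fix x assume x: "x \<in> U"
    then obtain V where V: "finite {i\<in>UNIV. V i \<noteq> topspace (discrete_topology A)}"
      "x \<in> Pi\<^sub>E UNIV V" "Pi\<^sub>E UNIV V \<subseteq> U"
      using l[unfolded full_shift_def openin_product_topology_alt, rule_format, OF x] by auto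
    define K where "K = nat (Max (insert 0 (abs ` {i. V i \<noteq> A})))"
    have K: "\<bar>i\<bar> \<le> int K" if "V i \<noteq> A" for i
    proof -
      have "\<bar>i\<bar> \<le> Max (insert 0 (abs ` {i. V i \<noteq> A}))"
        using V(1) that by (intro Max_ge) auto
      then show ?thesis unfolding K_def by linarith
    qed
    have "y \<in> U" if y: "y \<in> topspace (full_shift A)" "agree K x y" for y
    proof -
      have "y i \<in> V i" for i
      proof (cases "V i = A")
        case True then show ?thesis using y by (auto simp: topspace_full)
      next
        case False
        then have "x i = y i" using K y(2) by (simp add: agree_def)
        then show ?thesis using PiE_mem[OF V(2), of i] by simp
      qed
      then show ?thesis using V(3) by (auto simp: PiE_def extensional_def)
    qed
    then show "\<exists>K. \<forall>y\<in>topspace (full_shift A). agree K x y \<longrightarrow> y \<in> U" by blast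
  qed
next
  assume r: ?r
  show ?l
    unfolding full_shift_def openin_product_topology_alt
  proof (intro ballI)
    fix x assume x: "x \<in> U"
    then obtain K where K: "\<And>y. y\<in>topspace (full_shift A) \<Longrightarrow> agree K x y \<Longrightarrow> y \<in> U"
      using r by blast
    have xA: "x i \<in> A" for i using r x by (auto simp: topspace_full)
    let ?V = "\<lambda>i. if \<bar>i\<bar> \<le> int K then {x i} else A"
    have "{i \<in> UNIV. ?V i \<noteq> topspace (discrete_topology A)} \<subseteq> {- int K..int K}"
      by auto
    then have "finite {i \<in> UNIV. ?V i \<noteq> topspace (discrete_topology A)}"
      using finite_subset by blast
    moreover have "\<forall>i\<in>UNIV. openin (discrete_topology A) (?V i)" using xA by auto
    moreover have "x \<in> Pi\<^sub>E UNIV ?V" using xA by (auto simp: PiE_def extensional_def)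
    moreover have "Pi\<^sub>E UNIV ?V \<subseteq> U"
    proof
      fix y assume y: "y \<in> Pi\<^sub>E UNIV ?V"
      have yV: "y i \<in> ?V i" for i using PiE_mem[OF y, of i] by simp
      have "y i \<in> A" for i using yV[of i] xA[of i] by (auto split: if_splits)
      moreover have "agree K x y" unfolding agree_def
      proof (intro allI impI)
        fix i :: int assume "\<bar>i\<bar> \<le> int K" then show "x i = y i" using yV[of i] by simp
      qed
      ultimately show "y \<in> U" by (intro K) (auto simp: topspace_full)
    qed
    ultimately show "\<exists>V. finite {i \<in> UNIV. V i \<noteq> topspace (discrete_topology A)} \<and>
            (\<forall>i\<in>UNIV. openin (discrete_topology A) (V i)) \<and> x \<in> Pi\<^sub>E UNIV V \<and> Pi\<^sub>E UNIV V \<subseteq> U"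
      by (intro exI[of _ ?V] conjI)
  qed
qed

lemma openin_T:
  "openin T U \<longleftrightarrow> U \<subseteq> X \<and> (\<forall>x\<in>U. \<exists>K. \<forall>y\<in>X. agree K x y \<longrightarrow> y \<in> U)" (is "?l \<longleftrightarrow> ?r")
proof
  assume ?l
  then obtain V where "openin (full_shift A) V" "U = V \<inter> X"
    by (auto simp: openin_subtopology)
  then show ?r unfolding openin_full using X_subset by blast
next
  assume r: ?r
  \<comment> \<open>The union of the full-shift cylinders around points of \<open>U\<close> whose
    trace on \<open>X\<close> stays in \<open>U\<close>: an open set of the full shift that extends
    \<open>U\<close>.\<close>
  let ?V = "{y \<in> topspace (full_shift A). \<exists>x\<in>U. \<exists>K. (\<forall>y\<in>X. agree K x y \<longrightarrow> y \<in> U) \<and> agree K x y}"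
  have "openin (full_shift A) ?V"
    unfolding openin_full
  proof (intro conjI ballI)
    fix z assume "z \<in> ?V"
    then obtain x K where "x \<in> U" "\<forall>y\<in>X. agree K x y \<longrightarrow> y \<in> U" "agree K x z" by blast
    then have "\<forall>y\<in>topspace (full_shift A). agree K z y \<longrightarrow> y \<in> ?V"
      using agree_trans[of K x z] by blast
    then show "\<exists>K. \<forall>y\<in>topspace (full_shift A). agree K z y \<longrightarrow> y \<in> ?V" ..
  qed auto
  moreover have "U = ?V \<inter> X"
  proof
    show "U \<subseteq> ?V \<inter> X"
    proof
      fix x assume x: "x \<in> U"
      then obtain K where "\<forall>y\<in>X. agree K x y \<longrightarrow> y \<in> U" using r by blast
      then show "x \<in> ?V \<inter> X" using x r X_subset agree_refl[of K x] by blast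
    qed
  qed blast
  ultimately show ?l unfolding openin_subtopology by blast
qed

lemma sh_X: "x \<in> X \<Longrightarrow> sh n x \<in> X"
proof -
  have im: "sh 1 ` X = X" using subshift by (simp add: subshift_def seq_shift_eq_sh)
  have p: "sh 1 x \<in> X" if "x \<in> X" for x using im that by blast
  have m: "sh (-1) x \<in> X" if "x \<in> X" for x
  proof -
    obtain y where "y \<in> X" "x = sh 1 y" using im \<open>x \<in> X\<close> by blast
    then show ?thesis by simp
  qed
  have "sh (int k) x \<in> X \<and> sh (- int k) x \<in> X" if "x \<in> X" for k
  proof (induction k)
    case (Suc k)
    then show ?case using p[of "sh (int k) x"] m[of "sh (- int k) x"]
      by (simp add: algebra_simps)
  qed (simp add: that)
  then show "x \<in> X \<Longrightarrow> sh n x \<in> X" by (cases n rule: int_cases2) auto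
qed

lemma sh_X_iff [simp]: "sh n x \<in> X \<longleftrightarrow> x \<in> X"
  using sh_X[of "sh n x" "-n"] sh_X by fastforce

text \<open>All uniform window sizes and bounds below come from this form of compactness.\<close>

lemma compact_chain:
  fixes V :: "nat \<Rightarrow> (int \<Rightarrow> 'a) set"
  assumes op: "\<And>n x. x \<in> V n \<Longrightarrow> x \<in> X \<Longrightarrow> \<exists>K. \<forall>y\<in>X. agree K x y \<longrightarrow> y \<in> V n"
    and mono: "\<And>m n. m \<le> n \<Longrightarrow> V m \<subseteq> V n"
    and cov: "\<And>x. x \<in> X \<Longrightarrow> \<exists>n. x \<in> V n"
  shows "\<exists>n. X \<subseteq> V n"
proof -
  let ?U = "range (\<lambda>n. V n \<inter> X)"
  have "openin T (V n \<inter> X)" for n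
    unfolding openin_T using op by auto
  then have "\<forall>W\<in>?U. openin T W" by auto
  moreover have "topspace T \<subseteq> \<Union>?U" using cov by auto
  ultimately obtain F where F: "finite F" "F \<subseteq> ?U" "X \<subseteq> \<Union>F"
    using compact_T[unfolded compact_space_alt, rule_format, of ?U] unfolding topspace_T by blast
  then obtain I where I: "finite I" "F = (\<lambda>n. V n \<inter> X) ` I"
    by (meson finite_subset_image)
  define n where "n = Max (insert 0 I)"
  have "V i \<subseteq> V n" if "i \<in> I" for i using I(1) that mono[of i n] by (auto simp: n_def)
  then show ?thesis using F(3) I(2) by blast
qed

lemma continuous_imp_local:
  assumes "continuous_map T (discrete_topology UNIV) n"
  shows "\<exists>K. local_on X K n"
proof -
  have nbh: "\<exists>K. \<forall>y\<in>X. agree K x y \<longrightarrow> n y = n x" if "x \<in> X" for x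
  proof -
    have "openin T {y \<in> topspace T. n y \<in> {n x}}"
      using assms by (rule openin_continuous_map_preimage) auto
    then have "\<forall>x\<in>{y \<in> X. n y \<in> {n x}}. \<exists>K. \<forall>y\<in>X. agree K x y \<longrightarrow> y \<in> {y \<in> X. n y \<in> {n x}}"
      unfolding openin_T topspace_T by simp
    from bspec[OF this, of x] show ?thesis using that by simp
  qed
  \<comment> \<open>The points whose \<open>K\<close>-window already determines \<open>n\<close>.
    This is a union of cylinders, hence open, and it grows with \<open>K\<close>.\<close>
  define V where "V K = {x\<in>X. \<forall>y\<in>X. agree K x y \<longrightarrow> n y = n x}" for K
  have "\<exists>K. X \<subseteq> V K"
  proof (rule compact_chain)
    show "V m \<subseteq> V n" if "m \<le> n" for m n using that unfolding V_def by (auto dest: agree_mono)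
    show "\<exists>K. x \<in> V K" if "x \<in> X" for x using that nbh[OF that] by (auto simp: V_def)
    fix K x assume x: "x \<in> V K" "x \<in> X"
    then have n: "n z = n x" if "z \<in> X" "agree K x z" for z
      using that unfolding V_def by blast
    have "y \<in> V K" if y: "y \<in> X" "agree K x y" for y
    proof -
      have "n z = n y" if "z \<in> X" "agree K y z" for z
        using n[OF that(1) agree_trans[OF y(2) that(2)]] n[OF y] by simp
      then show ?thesis using y unfolding V_def by blast
    qed
    then show "\<exists>K'. \<forall>y\<in>X. agree K' x y \<longrightarrow> y \<in> V K" by blast
  qed
  then obtain K where K: "X \<subseteq> V K" ..
  have "local_on X K n"
    unfolding local_on_def
  proof (intro ballI impI)
    fix x y assume "x \<in> X" "y \<in> X" "agree K x y"
    moreover from this have "x \<in> V K" using K by blast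
    ultimately have "n y = n x" unfolding V_def by blast
    then show "n x = n y" ..
  qed
  then show ?thesis ..
qed

lemma local_imp_continuous:
  assumes "local_on X K n"
  shows "continuous_map T (discrete_topology UNIV) n"
  unfolding continuous_map_def openin_T topspace_T
proof (intro conjI allI impI ballI)
  fix U x assume x: "x \<in> {x \<in> X. n x \<in> U}"
  have "y \<in> {x \<in> X. n x \<in> U}" if "y \<in> X" "agree K x y" for y
    using local_onD[OF assms, of x y] x that by auto
  then show "\<exists>K. \<forall>y\<in>X. agree K x y \<longrightarrow> y \<in> {x \<in> X. n x \<in> U}" by blast
qed auto

lemma local_imp_bounded:
  fixes n :: "(int \<Rightarrow> 'a) \<Rightarrow> int"
  assumes "local_on X K n"
  shows "\<exists>b. \<forall>x\<in>X. \<bar>n x\<bar> \<le> int b"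
proof -
  have "\<exists>b. X \<subseteq> {x. \<bar>n x\<bar> \<le> int b}"
  proof (rule compact_chain)
    fix x b assume "x \<in> {x. \<bar>n x\<bar> \<le> int b}" "x \<in> X"
    then show "\<exists>K. \<forall>y\<in>X. agree K x y \<longrightarrow> y \<in> {x. \<bar>n x\<bar> \<le> int b}"
      using assms by (metis local_onD mem_Collect_eq)
  next
    show "\<exists>b. x \<in> {x. \<bar>n x\<bar> \<le> int b}" for x by (auto intro: exI[of _ "nat \<bar>n x\<bar>"])
  qed auto
  then show ?thesis by auto
qed

end

locale aperiodic_subshift = finite_subshift A X
  for A :: "'a set" and X :: "(int \<Rightarrow> 'a) set" +
  assumes nonempty: "X \<noteq> {}"
    and aperiodic: "\<And>x n. x \<in> X \<Longrightarrow> sh n x = x \<Longrightarrow> n = 0"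
begin

lemma sh_inj: "x \<in> X \<Longrightarrow> sh a x = sh b x \<longleftrightarrow> a = b"
  using aperiodic[of x "b - a"] by (auto simp: sh_eq_iff dest: sym)

text \<open>Aperiodicity gives, for one point and each of the finitely many \<open>d\<close>, a
  coordinate where the point and its shift differ, so some window serves this point; compactness
  makes the window uniform.\<close>

lemma separation:
  "\<exists>K. \<forall>x\<in>X. \<forall>d. d \<noteq> 0 \<and> \<bar>d\<bar> \<le> int N \<longrightarrow> \<not> agree K x (sh d x)"
proof -
  have "\<exists>K. X \<subseteq> {x. \<forall>d. d \<noteq> 0 \<and> \<bar>d\<bar> \<le> int N \<longrightarrow> \<not> agree K x (sh d x)}"
  proof (rule compact_chain)
    fix K x assume x: "x \<in> {x. \<forall>d. d \<noteq> 0 \<and> \<bar>d\<bar> \<le> int N \<longrightarrow> \<not> agree K x (sh d x)}" "x \<in> X"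
    \<comment> \<open>Moving by \<open>d\<close> costs up to \<open>N\<close> coordinates, hence the
      window \<open>K + N\<close> to keep \<open>sh d x\<close> and \<open>sh d y\<close> equal on
      the \<open>K\<close>-window.\<close>
    have "\<not> agree K y (sh d y)" if "agree (K + N) x y" "d \<noteq> 0" "\<bar>d\<bar> \<le> int N" for y d
    proof
      assume "agree K y (sh d y)"
      moreover have "agree K x y" by (rule agree_mono[OF that(1)]) simp
      moreover have "agree K (sh d y) (sh d x)"
        by (rule agree_sh[OF agree_sym[OF that(1)]]) (use that in auto)
      ultimately have "agree K x (sh d x)" using agree_trans[of K] by blast
      then show False using x(1) that(2,3) by blast
    qed
    then show "\<exists>K'. \<forall>y\<in>X. agree K' x y \<longrightarrow> y \<in> {x. \<forall>d. d \<noteq> 0 \<and> \<bar>d\<bar> \<le> int N \<longrightarrow> \<not> agree K x (sh d x)}"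
      by blast
  next
    fix m n :: nat assume "m \<le> n"
    then show "{x. \<forall>d. d \<noteq> 0 \<and> \<bar>d\<bar> \<le> int N \<longrightarrow> \<not> agree m x (sh d x)}
       \<subseteq> {x. \<forall>d. d \<noteq> 0 \<and> \<bar>d\<bar> \<le> int N \<longrightarrow> \<not> agree n x (sh d x)}"
      using agree_mono[OF _ \<open>m \<le> n\<close>] by blast
  next
    fix x assume x: "x \<in> X"
    have "\<exists>i. d \<noteq> 0 \<longrightarrow> x i \<noteq> sh d x i" for d
    proof (rule ccontr)
      assume "\<nexists>i. d \<noteq> 0 \<longrightarrow> x i \<noteq> sh d x i"
      then have "d \<noteq> 0" "sh d x = x" by (auto simp: fun_eq_iff)
      then show False using aperiodic[OF x] by blast
    qed
    then obtain f where f: "\<And>d. d \<noteq> 0 \<longrightarrow> x (f d) \<noteq> sh d x (f d)"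
      using choice[of "\<lambda>d i. d \<noteq> 0 \<longrightarrow> x i \<noteq> sh d x i"] by blast
    define M where "M = Max (insert 0 ((\<lambda>d. \<bar>f d\<bar>) ` {- int N..int N}))"
    have M: "\<bar>f d\<bar> \<le> int (nat M)" if "\<bar>d\<bar> \<le> int N" for d
    proof -
      have "d \<in> {- int N..int N}" using that by auto
      then have "\<bar>f d\<bar> \<le> M"
        unfolding M_def by (intro Max_ge insertI2 imageI finite.insertI finite_imageI) auto
      then show ?thesis by linarith
    qed
    have "\<not> agree (nat M) x (sh d x)" if "d \<noteq> 0" "\<bar>d\<bar> \<le> int N" for d
      using f[of d] M[OF that(2)] that(1) unfolding agree_def by blast
    then show "\<exists>K. x \<in> {x. \<forall>d. d \<noteq> 0 \<and> \<bar>d\<bar> \<le> int N \<longrightarrow> \<not> agree K x (sh d x)}" by blast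
  qed
  then show ?thesis by blast
qed

section \<open>Cocycles\<close>

text \<open>Without periodic points the displacement is unique, so one canonical function replaces
  the existentially quantified cocycle.\<close>

definition coc :: "((int \<Rightarrow> 'a) \<Rightarrow> (int \<Rightarrow> 'a)) \<Rightarrow> (int \<Rightarrow> 'a) \<Rightarrow> int" where
  "coc \<gamma> x = (THE k. \<gamma> x = sh k x)"

lemma coc_eqI: "x \<in> X \<Longrightarrow> \<gamma> x = sh k x \<Longrightarrow> coc \<gamma> x = k"
  unfolding coc_def by (rule the_equality) (auto simp: sh_inj)

text \<open>The carrier of \<open>full_group\<close> in combinatorial terms, with locality of the
  displacement in place of continuity; \<open>carrier_full_group\<close> is the equality.\<close>

definition FG :: "((int \<Rightarrow> 'a) \<Rightarrow> (int \<Rightarrow> 'a)) set" where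
  "FG = {\<gamma> \<in> Bij X. (\<forall>x\<in>X. \<gamma> x = sh (coc \<gamma> x) x) \<and> (\<exists>K. local_on X K (coc \<gamma>))}"

lemma FG_I:
  assumes "\<gamma> \<in> Bij X" "\<And>x. x \<in> X \<Longrightarrow> \<gamma> x = sh (n x) x" "local_on X K n"
  shows "\<gamma> \<in> FG"
proof -
  have c: "coc \<gamma> x = n x" if "x \<in> X" for x using assms(2) that by (intro coc_eqI) auto
  have "local_on X K (coc \<gamma>)"
    unfolding local_on_def
  proof (intro ballI impI)
    fix x y assume xy: "x \<in> X" "y \<in> X" "agree K x y"
    show "coc \<gamma> x = coc \<gamma> y" using c[OF xy(1)] c[OF xy(2)] local_onD[OF assms(3) xy] by simp
  qed
  moreover have "\<gamma> x = sh (coc \<gamma> x) x" if "x \<in> X" for x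
    using assms(2)[OF that] c[OF that] by simp
  ultimately show ?thesis unfolding FG_def using assms(1) by blast
qed

lemma FG_coc: "\<gamma> \<in> FG \<Longrightarrow> x \<in> X \<Longrightarrow> \<gamma> x = sh (coc \<gamma> x) x"
  by (simp add: FG_def)

lemma FG_Bij: "\<gamma> \<in> FG \<Longrightarrow> \<gamma> \<in> Bij X"
  by (simp add: FG_def)

lemma FG_bij: "\<gamma> \<in> FG \<Longrightarrow> bij_betw \<gamma> X X"
  by (simp add: FG_def Bij_def)

lemma FG_mem: "\<gamma> \<in> FG \<Longrightarrow> x \<in> X \<Longrightarrow> \<gamma> x \<in> X"
  using FG_bij bij_betwE by blast

lemma FG_local: "\<gamma> \<in> FG \<Longrightarrow> \<exists>K. local_on X K (coc \<gamma>)"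
  by (simp add: FG_def)

lemma sh_cocycle_continuous:
  assumes "\<And>x. x \<in> X \<Longrightarrow> \<gamma> x = sh (n x) x" "local_on X K n"
  shows "continuous_map T T \<gamma>"
  unfolding continuous_map_def topspace_T
proof (intro conjI allI impI)
  show "\<gamma> \<in> X \<rightarrow> X" using assms(1) by auto
  fix U assume U: "openin T U"
  show "openin T {x \<in> X. \<gamma> x \<in> U}"
    unfolding openin_T
  proof (intro conjI ballI)
    fix x assume x: "x \<in> {x \<in> X. \<gamma> x \<in> U}"
    then obtain L where L: "\<And>y. y\<in>X \<Longrightarrow> agree L (\<gamma> x) y \<Longrightarrow> y \<in> U"
      using U unfolding openin_T by blast
    let ?M = "K + (L + nat \<bar>n x\<bar>)"
    have "y \<in> {x \<in> X. \<gamma> x \<in> U}" if y: "y \<in> X" "agree ?M x y" for y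
    proof -
      have n: "n x = n y" using local_onD[OF assms(2), of x y] x y agree_mono[OF y(2), of K] by auto
      have "agree L (sh (n x) x) (sh (n x) y)" by (rule agree_sh[OF y(2)]) simp
      then have "agree L (\<gamma> x) (\<gamma> y)" using assms(1) n x y(1) by simp
      then have "\<gamma> y \<in> U" using L y(1) assms(1) by simp
      then show ?thesis using y by simp
    qed
    then show "\<exists>K. \<forall>y\<in>X. agree K x y \<longrightarrow> y \<in> {x \<in> X. \<gamma> x \<in> U}" by blast
  qed auto
qed

text \<open>A local displacement makes the bijection continuous, and continuity of the inverse is
  automatic from a compact to a Hausdorff space.\<close>

lemma carrier_full_group: "carrier (full_group A X) = FG"
proof
  show "carrier (full_group A X) \<subseteq> FG"
  proof
    fix \<gamma> assume "\<gamma> \<in> carrier (full_group A X)"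
    then obtain n where n: "\<gamma> \<in> extensional X" "homeomorphic_map T T \<gamma>" "is_cocycle A X \<gamma> n"
      by (auto simp: full_group_def)
    have "inj_on \<gamma> X" "\<gamma> ` X = X"
      using homeomorphic_imp_injective_map[OF n(2)] homeomorphic_imp_surjective_map[OF n(2)]
      unfolding topspace_T by auto
    then have "\<gamma> \<in> Bij X" using n(1) by (simp add: Bij_def bij_betw_def)
    moreover obtain K where "local_on X K n" using n continuous_imp_local unfolding is_cocycle_def by blast
    ultimately show "\<gamma> \<in> FG" using n by (intro FG_I) (auto simp: is_cocycle_def)
  qed
  show "FG \<subseteq> carrier (full_group A X)"
  proof
    fix \<gamma> assume g: "\<gamma> \<in> FG"
    then obtain K where K: "local_on X K (coc \<gamma>)" using FG_local by blast
    have "is_cocycle A X \<gamma> (coc \<gamma>)"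
      unfolding is_cocycle_def using local_imp_continuous[OF K] FG_coc[OF g] by blast
    moreover have "continuous_map T T \<gamma>" by (rule sh_cocycle_continuous[OF FG_coc[OF g] K])
    then have "homeomorphic_map T T \<gamma>"
      using FG_bij[OF g] by (intro continuous_imp_homeomorphic_map compact_T Hausdorff_T)
        (auto simp: bij_betw_def)
    ultimately show "\<gamma> \<in> carrier (full_group A X)"
      using g by (auto simp: full_group_def FG_def Bij_def)
  qed
qed

lemma full_group_eq: "full_group A X = BijGroup X \<lparr>carrier := FG\<rparr>"
  using carrier_full_group unfolding full_group_def by simp

lemma is_cocycle_coc: "is_cocycle A X \<gamma> n \<Longrightarrow> x \<in> X \<Longrightarrow> n x = coc \<gamma> x"
  using coc_eqI[of x \<gamma> "n x"] by (simp add: is_cocycle_def)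

lemma FG_is_cocycle: "\<gamma> \<in> FG \<Longrightarrow> is_cocycle A X \<gamma> (coc \<gamma>)"
  unfolding is_cocycle_def using FG_local[of \<gamma>] local_imp_continuous FG_coc[of \<gamma>] by blast

lemma coc_compose:
  assumes "\<gamma> \<in> FG" "\<delta> \<in> FG" "x \<in> X"
  shows "coc (compose X \<gamma> \<delta>) x = coc \<gamma> (\<delta> x) + coc \<delta> x"
proof (rule coc_eqI[OF assms(3)])
  have "compose X \<gamma> \<delta> x = \<gamma> (\<delta> x)" using assms(3) by (simp add: compose_def)
  also have "\<dots> = sh (coc \<gamma> (\<delta> x)) (\<delta> x)" using FG_coc[OF assms(1) FG_mem[OF assms(2,3)]] .
  also have "\<dots> = sh (coc \<gamma> (\<delta> x)) (sh (coc \<delta> x) x)"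
    using FG_coc[OF assms(2,3)] by simp
  finally show "compose X \<gamma> \<delta> x = sh (coc \<gamma> (\<delta> x) + coc \<delta> x) x" by simp
qed

lemma compose_FG:
  assumes "\<gamma> \<in> FG" "\<delta> \<in> FG"
  shows "compose X \<gamma> \<delta> \<in> FG"
proof -
  obtain K where K: "local_on X K (coc \<gamma>)" using FG_local assms(1) by blast
  obtain L where L: "local_on X L (coc \<delta>)" using FG_local assms(2) by blast
  obtain b where b: "\<And>x. x\<in>X \<Longrightarrow> \<bar>coc \<delta> x\<bar> \<le> int b" using local_imp_bounded[OF L] by blast
  \<comment> \<open>\<open>L\<close> determines the displacement by \<open>\<delta>\<close>, which
    is at most \<open>b\<close>, so the \<open>(K + b)\<close>-window of \<open>x\<close> shows the
    \<open>K\<close>-window of \<open>\<delta> x\<close>.\<close>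
  have loc: "local_on X (K + L + b) (\<lambda>x. coc \<gamma> (\<delta> x) + coc \<delta> x)"
    unfolding local_on_def
  proof (intro ballI impI)
    fix x y assume xy: "x \<in> X" "y \<in> X" "agree (K + L + b) x y"
    have d: "coc \<delta> x = coc \<delta> y"
      using xy by (intro local_onD[OF L]) (auto intro: agree_mono)
    have "agree K (sh (coc \<delta> x) x) (sh (coc \<delta> x) y)"
      by (rule agree_sh[OF xy(3)]) (use b[OF xy(1)] in linarith)
    then have "agree K (\<delta> x) (\<delta> y)"
      using FG_coc[OF assms(2) xy(1)] FG_coc[OF assms(2) xy(2)] d by simp
    then have "coc \<gamma> (\<delta> x) = coc \<gamma> (\<delta> y)"
      using xy FG_mem[OF assms(2)] by (intro local_onD[OF K]) auto
    then show "coc \<gamma> (\<delta> x) + coc \<delta> x = coc \<gamma> (\<delta> y) + coc \<delta> y" using d by simp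
  qed
  have eq: "compose X \<gamma> \<delta> x = sh (coc \<gamma> (\<delta> x) + coc \<delta> x) x" if x: "x \<in> X" for x
  proof -
    have "\<gamma> (\<delta> x) = sh (coc \<gamma> (\<delta> x)) (\<delta> x)" using FG_coc[OF assms(1) FG_mem[OF assms(2) x]] .
    also have "\<dots> = sh (coc \<gamma> (\<delta> x)) (sh (coc \<delta> x) x)"
      using FG_coc[OF assms(2) x] by simp
    finally show ?thesis using x by (simp add: compose_def)
  qed
  show ?thesis by (rule FG_I[OF compose_Bij[OF FG_Bij FG_Bij, OF assms] eq loc])
qed

lemma inv_FG:
  assumes "\<gamma> \<in> FG"
  shows "(\<lambda>x\<in>X. inv_into X \<gamma> x) \<in> FG"
proof -
  let ?i = "inv_into X \<gamma>"
  have im: "\<gamma> ` X = X" and inj: "inj_on \<gamma> X" using FG_bij[OF assms] by (auto simp: bij_betw_def)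
  have iX: "?i x \<in> X" if "x \<in> X" for x using im that by (metis inv_into_into)
  have gi: "\<gamma> (?i x) = x" if "x \<in> X" for x using im that by (metis f_inv_into_f)
  obtain K where K: "local_on X K (coc \<gamma>)" using FG_local assms by blast
  obtain b where b: "\<And>x. x\<in>X \<Longrightarrow> \<bar>coc \<gamma> x\<bar> \<le> int b" using local_imp_bounded[OF K] by blast
  have i: "?i x = sh (- coc \<gamma> (?i x)) x" if "x \<in> X" for x
  proof -
    have "x = sh (coc \<gamma> (?i x)) (?i x)" using FG_coc[OF assms iX[OF that]] gi[OF that] by simp
    then have "sh (- coc \<gamma> (?i x)) x = sh (- coc \<gamma> (?i x)) (sh (coc \<gamma> (?i x)) (?i x))" by simp
    then show ?thesis by simp
  qed
  have loc: "local_on X (K + b) (\<lambda>x. - coc \<gamma> (?i x))"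
    unfolding local_on_def
  proof (intro ballI impI)
    fix x y assume xy: "x \<in> X" "y \<in> X" "agree (K + b) x y"
    let ?k = "coc \<gamma> (?i x)"
    have "agree K (sh (- ?k) x) (sh (- ?k) y)"
      by (rule agree_sh[OF xy(3)]) (use b[OF iX[OF xy(1)]] in linarith)
    \<comment> \<open>The candidate \<open>sh (- ?k) y\<close> looks like the preimage of
      \<open>x\<close>, so \<open>\<gamma>\<close> moves it by \<open>?k\<close>, that is, to
      \<open>y\<close>; by injectivity it is the preimage of \<open>y\<close>.\<close>
    then have "agree K (?i x) (sh (- ?k) y)" using i[OF xy(1)] by simp
    then have c: "coc \<gamma> (sh (- ?k) y) = ?k"
      using local_onD[OF K iX[OF xy(1)], of "sh (- ?k) y"] xy(2) by simp
    have "\<gamma> (sh (- ?k) y) = y" using FG_coc[OF assms, of "sh (- ?k) y"] xy(2) c by simp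
    then have "?i y = sh (- ?k) y" using inv_into_f_f[OF inj, of "sh (- ?k) y"] xy(2) by simp
    then show "- ?k = - coc \<gamma> (?i y)" using c by simp
  qed
  have "(\<lambda>x\<in>X. ?i x) x = sh (- coc \<gamma> (?i x)) x" if "x \<in> X" for x
    using i[OF that] that by simp
  from FG_I[OF restrict_inv_into_Bij[OF FG_Bij[OF assms]] this loc] show ?thesis .
qed

lemma id_FG: "(\<lambda>x\<in>X. x) \<in> FG"
  by (rule FG_I[where n = "\<lambda>_. 0" and K = 0]) (auto simp: id_Bij local_on_def)

end

section \<open>Invariant measures and the index map\<close>

text \<open>The mean is a cluster point, in the compact space of \<open>[0,1]\<close>-valued set functions, of the
  empirical measures along the orbit of \<open>x0\<close>.\<close>

lemma invariant_mean_exists: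
  fixes f :: "'b \<Rightarrow> 'b" and x0 :: 'b
  shows "\<exists>q :: 'b set \<Rightarrow> real. (\<forall>C. 0 \<le> q C) \<and> (\<forall>C D. C \<inter> D = {} \<longrightarrow> q (C \<union> D) = q C + q D) \<and>
    (\<forall>C. q (f -` C) = q C) \<and> (\<forall>C. (\<forall>n. (f ^^ n) x0 \<in> C) \<longrightarrow> q C = 1)"
proof -
  define S :: "('b set \<Rightarrow> real) set" where "S = Pi\<^sub>E UNIV (\<lambda>_. {0..1})"
  define Q :: "nat \<Rightarrow> ('b set \<Rightarrow> real) set" where
    "Q n = {q. (\<forall>C D. C \<inter> D = {} \<longrightarrow> q (C \<union> D) = q C + q D) \<and>
      (\<forall>C. \<bar>q (f -` C) - q C\<bar> \<le> 1 / real (Suc n)) \<and> (\<forall>C. (\<forall>n. (f ^^ n) x0 \<in> C) \<longrightarrow> q C = 1)}" for n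
  define emp :: "nat \<Rightarrow> 'b set \<Rightarrow> real" where
    "emp n C = (\<Sum>i<Suc n. indicat_real C ((f ^^ i) x0)) / real (Suc n)" for n C
  have "compact S"
  proof -
    have "compactin (product_topology (\<lambda>_. euclidean) UNIV) S"
      unfolding S_def compactin_PiE by simp
    then show ?thesis by (simp add: euclidean_product_topology)
  qed
  \<comment> \<open>For fixed sets each condition involves finitely many values of \<open>q\<close>,
    and evaluation is continuous in the product topology.\<close>
  moreover have "closed (Q n)" for n
    unfolding Q_def
    by (intro closed_Collect_conj closed_Collect_all closed_Collect_imp open_Collect_const
        closed_Collect_eq closed_Collect_le continuous_intros continuous_on_product_coordinates)
  moreover have "S \<inter> (\<Inter>n\<in>I. Q n) \<noteq> {}" if "finite I" for I
  proof -
    \<comment> \<open>The \<open>Q n\<close> decrease, so a single empirical measure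
      \<open>emp N\<close> lies in all those with index in \<open>I\<close>. The 0 covers empty
      \<open>I\<close>.\<close>
    define N where "N = Max (insert 0 I)"
    have "emp N \<in> S"
    proof -
      have "emp N C \<in> {0..1}" for C
      proof -
        have "(\<Sum>i<Suc N. indicat_real C ((f ^^ i) x0)) \<le> (\<Sum>i<Suc N. 1)"
          by (intro sum_mono) (simp add: indicator_def)
        moreover have "0 \<le> (\<Sum>i<Suc N. indicat_real C ((f ^^ i) x0))"
          by (intro sum_nonneg) (simp add: indicator_def)
        ultimately show ?thesis unfolding emp_def by (simp del: sum.lessThan_Suc)
      qed
      then show ?thesis by (auto simp: S_def)
    qed
    moreover have "emp N \<in> Q n" if "n \<in> I" for n
    proof -
      have nN: "n \<le> N" using \<open>finite I\<close> that by (simp add: N_def)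
      have "emp N (C \<union> D) = emp N C + emp N D" if "C \<inter> D = {}" for C D
      proof -
        have "indicat_real (C \<union> D) y = indicat_real C y + indicat_real D y" for y
          using that by (auto simp: indicator_def)
        then show ?thesis unfolding emp_def by (simp add: sum.distrib add_divide_distrib del: sum.lessThan_Suc)
      qed
      moreover have "\<bar>emp N (f -` C) - emp N C\<bar> \<le> 1 / real (Suc n)" for C
      proof -
        let ?g = "\<lambda>i. indicat_real C ((f ^^ i) x0)"
        have "emp N (f -` C) = (\<Sum>i<Suc N. ?g (Suc i)) / real (Suc N)"
          unfolding emp_def by (simp add: indicator_def del: sum.lessThan_Suc)
        then have "emp N (f -` C) - emp N C = (\<Sum>i<Suc N. ?g (Suc i) - ?g i) / real (Suc N)"
          unfolding emp_def by (simp add: sum_subtractf diff_divide_distrib del: sum.lessThan_Suc)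
        \<comment> \<open>The sums over an orbit segment and over its shift differ only at the two
          ends.\<close>
        also have "\<dots> = (?g (Suc N) - ?g 0) / real (Suc N)"
          by (subst sum_lessThan_telescope) simp
        finally have "\<bar>emp N (f -` C) - emp N C\<bar> = \<bar>?g (Suc N) - ?g 0\<bar> / real (Suc N)" by simp
        also have "\<dots> \<le> 1 / real (Suc N)"
          by (intro divide_right_mono) (auto simp: indicator_def)
        also have "\<dots> \<le> 1 / real (Suc n)" using nN by (intro divide_left_mono) auto
        finally show ?thesis .
      qed
      moreover have "emp N C = 1" if "\<forall>n. (f ^^ n) x0 \<in> C" for C
        using that unfolding emp_def by (simp del: sum.lessThan_Suc)
      ultimately show ?thesis unfolding Q_def by blast
    qed
    ultimately show ?thesis by blast
  qed
  ultimately have "S \<inter> (\<Inter>n\<in>UNIV. Q n) \<noteq> {}" by (rule compact_imp_fip_image)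
  then obtain q where q: "q \<in> S" "\<And>n. q \<in> Q n" by blast
  have "q (f -` C) = q C" for C
  proof (rule ccontr)
    assume "q (f -` C) \<noteq> q C"
    then obtain n where "1 / real (Suc n) < \<bar>q (f -` C) - q C\<bar>"
      using nat_approx_posE[of "\<bar>q (f -` C) - q C\<bar>"] by auto
    moreover have "\<bar>q (f -` C) - q C\<bar> \<le> 1 / real (Suc n)" using q(2)[of n] unfolding Q_def by blast
    ultimately show False by simp
  qed
  moreover have "0 \<le> q C" for C using PiE_mem[OF q(1)[unfolded S_def], of C] by simp
  ultimately show ?thesis using q(2)[of 0] unfolding Q_def by blast
qed

context aperiodic_subshift
begin

text \<open>By compactness these are the clopen subsets of \<open>X\<close>. They form a ring that
  generates the Borel sets, so measures are built and compared on them.\<close>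

definition clopens :: "(int \<Rightarrow> 'a) set set" where
  "clopens = {U. U \<subseteq> X \<and> (\<exists>K. local_on X K (\<lambda>x. x \<in> U))}"

lemma clopensI:
  assumes "U \<subseteq> X" "\<And>x y. x \<in> U \<Longrightarrow> y \<in> X \<Longrightarrow> agree K x y \<Longrightarrow> y \<in> U"
  shows "U \<in> clopens"
  unfolding clopens_def local_on_def using assms agree_sym[of K] by blast

lemma clopensE:
  assumes "U \<in> clopens"
  obtains K where "U \<subseteq> X" "\<And>x y. x \<in> U \<Longrightarrow> y \<in> X \<Longrightarrow> agree K x y \<Longrightarrow> y \<in> U"
  using assms unfolding clopens_def local_on_def by blast

lemma clopens_subset: "U \<in> clopens \<Longrightarrow> U \<subseteq> X"
  by (simp add: clopens_def)

lemma clopens_Un: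
  assumes "U \<in> clopens" "V \<in> clopens"
  shows "U \<union> V \<in> clopens"
proof -
  obtain K L where K: "\<And>x y. x \<in> U \<Longrightarrow> y \<in> X \<Longrightarrow> agree K x y \<Longrightarrow> y \<in> U"
    and L: "\<And>x y. x \<in> V \<Longrightarrow> y \<in> X \<Longrightarrow> agree L x y \<Longrightarrow> y \<in> V" using assms by (metis clopensE)
  show ?thesis
  proof (rule clopensI[where K = "K + L"])
    show "U \<union> V \<subseteq> X" using assms clopens_subset by blast
    fix x y assume xy: "x \<in> U \<union> V" "y \<in> X" "agree (K + L) x y"
    then show "y \<in> U \<union> V"
      using agree_mono[OF xy(3), of K] agree_mono[OF xy(3), of L] K[of x y] L[of x y] by auto
  qed
qed

lemma clopens_Diff:
  assumes "U \<in> clopens" "V \<in> clopens"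
  shows "U - V \<in> clopens"
proof -
  obtain K L where K: "\<And>x y. x \<in> U \<Longrightarrow> y \<in> X \<Longrightarrow> agree K x y \<Longrightarrow> y \<in> U"
    and L: "\<And>x y. x \<in> V \<Longrightarrow> y \<in> X \<Longrightarrow> agree L x y \<Longrightarrow> y \<in> V" using assms by (metis clopensE)
  show ?thesis
  proof (rule clopensI[where K = "K + L"])
    show "U - V \<subseteq> X" using assms clopens_subset by blast
    fix x y assume xy: "x \<in> U - V" "y \<in> X" "agree (K + L) x y"
    have "y \<in> U" using xy agree_mono[OF xy(3), of K] K[of x y] by simp
    moreover have "y \<notin> V"
      using xy agree_sym[OF agree_mono[OF xy(3), of L]] L[of y x] clopens_subset[OF assms(1)] by auto
    ultimately show "y \<in> U - V" by blast
  qed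
qed

lemma clopens_Int: "U \<in> clopens \<Longrightarrow> V \<in> clopens \<Longrightarrow> U \<inter> V \<in> clopens"
  using clopens_Diff[OF _ clopens_Diff, of U U V] by (simp add: Diff_Diff_Int)

lemma clopens_empty: "{} \<in> clopens"
  by (rule clopensI) auto

lemma clopens_space: "X \<in> clopens"
  by (rule clopensI) auto

lemma clopens_vimage_sh:
  assumes "U \<in> clopens"
  shows "sh n -` U \<in> clopens"
proof -
  obtain K where K: "\<And>x y. x \<in> U \<Longrightarrow> y \<in> X \<Longrightarrow> agree K x y \<Longrightarrow> y \<in> U"
    using assms by (metis clopensE)
  show ?thesis
  proof (rule clopensI[where K = "K + nat \<bar>n\<bar>"])
    show "sh n -` U \<subseteq> X" using clopens_subset[OF assms] by auto
    fix x y assume "x \<in> sh n -` U" "y \<in> X" "agree (K + nat \<bar>n\<bar>) x y"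
    then show "y \<in> sh n -` U" using K[of "sh n x" "sh n y"] agree_sh[of "K + nat \<bar>n\<bar>" x y K n] by simp
  qed
qed

section \<open>Cylinders and the Borel sigma-algebra\<close>

definition cyl :: "nat \<Rightarrow> (int \<Rightarrow> 'a) \<Rightarrow> (int \<Rightarrow> 'a) set" where
  "cyl K x = {y \<in> X. agree K x y}"

lemma cyl_self: "x \<in> X \<Longrightarrow> x \<in> cyl K x"
  by (simp add: cyl_def)

lemma cyl_clopen: "cyl K x \<in> clopens"
  by (rule clopensI[where K = K]) (auto simp: cyl_def intro: agree_trans)

lemma cyl_eq: "y \<in> cyl K x \<Longrightarrow> cyl K y = cyl K x"
  using agree_trans[of K x y] agree_trans[of K y x] agree_sym[of K x y]
  unfolding cyl_def by blast

lemma finite_windows: "finite ((\<lambda>x. restrict x {- int K..int K}) ` X)"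
proof (rule finite_subset)
  show "(\<lambda>x. restrict x {- int K..int K}) ` X \<subseteq> Pi\<^sub>E {- int K..int K} (\<lambda>_. A)"
    using X_in_A by auto
qed (auto intro: finite_PiE finite_alphabet)

lemma restrict_eq_agree:
  "restrict x {- int K..int K} = restrict y {- int K..int K} \<longleftrightarrow> agree K x y"
proof
  assume h: "restrict x {- int K..int K} = restrict y {- int K..int K}"
  show "agree K x y"
    unfolding agree_def
  proof (intro allI impI)
    fix i :: int assume "\<bar>i\<bar> \<le> int K"
    then show "x i = y i" using fun_cong[OF h, of i] by (auto simp: restrict_def split: if_splits)
  qed
next
  assume "agree K x y"
  then show "restrict x {- int K..int K} = restrict y {- int K..int K}"
    by (intro restrict_ext) (auto simp: agree_def abs_le_iff)
qed

lemma finite_cyls: "finite (cyl K ` X)"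
proof -
  let ?r = "\<lambda>x. restrict x {- int K..int K}"
  have "cyl K ` X \<subseteq> (\<lambda>w. {y \<in> X. ?r y = w}) ` (?r ` X)"
  proof
    fix U assume "U \<in> cyl K ` X"
    then obtain x where x: "x \<in> X" "U = cyl K x" by blast
    have "cyl K x = {y \<in> X. ?r y = ?r x}"
      unfolding cyl_def restrict_eq_agree using agree_sym[of K] by blast
    then show "U \<in> (\<lambda>w. {y \<in> X. ?r y = w}) ` (?r ` X)" using x by blast
  qed
  then show ?thesis using finite_windows finite_surj finite_subset by (meson finite_imageI)
qed

text \<open>Every open set is the union of the cylinders it contains, and there are only countably
  many cylinders.\<close>

lemma sigma_sets_clopens: "sigma_sets X clopens = sigma_sets X {U. openin T U}"
proof (rule sigma_sets_eqI)
  fix U assume "U \<in> clopens"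
  then show "U \<in> sigma_sets X {U. openin T U}"
    by (intro sigma_sets.Basic) (auto simp: openin_T elim!: clopensE)
next
  fix U assume "U \<in> {U. openin T U}"
  then have U: "U \<subseteq> X" "\<And>x. x\<in>U \<Longrightarrow> \<exists>K. \<forall>y\<in>X. agree K x y \<longrightarrow> y \<in> U" by (auto simp: openin_T)
  let ?C = "{C \<in> (\<Union>K. cyl K ` X). C \<subseteq> U}"
  have "countable ?C"
    by (rule countable_subset[of _ "\<Union>K. cyl K ` X"]) (auto intro: countable_finite finite_cyls)
  moreover have "U = \<Union>?C"
  proof
    show "U \<subseteq> \<Union>?C"
    proof
      fix x assume x: "x \<in> U"
      then obtain K where "\<forall>y\<in>X. agree K x y \<longrightarrow> y \<in> U" using U(2) by blast
      then have "cyl K x \<subseteq> U" "x \<in> cyl K x" using x U(1) by (auto simp: cyl_def)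
      then show "x \<in> \<Union>?C" using x U(1) by blast
    qed
  qed blast
  moreover have "\<Union>?C \<in> sigma_sets X clopens"
  proof -
    interpret sigma_algebra X "sigma_sets X clopens"
      by (rule sigma_algebra_sigma_sets) (auto simp: clopens_def)
    show ?thesis using \<open>countable ?C\<close>
    proof (rule countable_Union)
      show "?C \<subseteq> sigma_sets X clopens" using cyl_clopen by (auto intro: sigma_sets.Basic)
    qed
  qed
  ultimately show "U \<in> sigma_sets X clopens" by simp
qed

lemma clopens_ring: "ring_of_sets X clopens"
  unfolding ring_of_sets_iff
  using clopens_subset clopens_empty clopens_Un clopens_Diff by blast

text \<open>Compactness in the form needed for Caratheodory's theorem: finitely additive set
  functions on \<open>clopens\<close> become continuous at the empty set.\<close>

lemma clopens_decseq_empty: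
  assumes "range C \<subseteq> clopens" "decseq C" "(\<Inter>i. C i) = {}"
  shows "\<exists>n::nat. C n = {}"
proof -
  have "\<exists>n. X \<subseteq> X - C n"
  proof (rule compact_chain)
    fix n x assume x: "x \<in> X - C n" "x \<in> X"
    have "X - C n \<in> clopens" using assms(1) clopens_space clopens_Diff by blast
    then obtain K where "\<And>x y. x \<in> X - C n \<Longrightarrow> y \<in> X \<Longrightarrow> agree K x y \<Longrightarrow> y \<in> X - C n"
      by (metis clopensE)
    then show "\<exists>K. \<forall>y\<in>X. agree K x y \<longrightarrow> y \<in> X - C n" using x by blast
  next
    fix m n :: nat assume "m \<le> n"
    then show "X - C m \<subseteq> X - C n" using assms(2) by (auto simp: decseq_def)
  next
    fix x assume "x \<in> X"
    then show "\<exists>n. x \<in> X - C n" using assms(3) by blast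
  qed
  then obtain n where "X \<subseteq> X - C n" ..
  moreover have "C n \<subseteq> X" using assms(1) clopens_subset by blast
  ultimately show ?thesis by blast
qed

lemma invariant_prob_exists: "\<exists>\<mu>. invariant_prob A X \<mu>"
proof -
  obtain x0 where x0: "x0 \<in> X" using nonempty by blast
  obtain q :: "(int \<Rightarrow> 'a) set \<Rightarrow> real" where q0: "\<And>C. 0 \<le> q C"
    and qadd: "\<And>C D. C \<inter> D = {} \<Longrightarrow> q (C \<union> D) = q C + q D"
    and qinv: "\<And>C. q (seq_shift -` C) = q C"
    and qorb: "\<And>C. (\<forall>n. (seq_shift ^^ n) x0 \<in> C) \<Longrightarrow> q C = 1"
    using invariant_mean_exists[of seq_shift x0] by blast
  \<comment> \<open>The mean is defined on all sets of sequences; it gives mass 1 to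
    \<open>X\<close> because the orbit of \<open>x0\<close> never leaves \<open>X\<close>.\<close>
  have qX: "q X = 1" using x0 by (intro qorb) (simp flip: seq_shift_pow_of_nat)
  have qe: "q {} = 0" using qadd[of "{}" "{}"] by simp
  interpret ring_of_sets X clopens by (rule clopens_ring)
  have "\<exists>m. (\<forall>s\<in>clopens. m s = ennreal (q s)) \<and> measure_space X (sigma_sets X clopens) m"
  proof (rule caratheodory_empty_continuous)
    show "positive clopens (\<lambda>s. ennreal (q s))" by (simp add: positive_def qe)
    show "additive clopens (\<lambda>s. ennreal (q s))"
      by (simp add: additive_def qadd q0 ennreal_plus)
    fix C :: "nat \<Rightarrow> _" assume C: "range C \<subseteq> clopens" "decseq C" "(\<Inter>i. C i) = {}"
    then obtain n where n: "C n = {}" using clopens_decseq_empty by blast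
    have "eventually (\<lambda>i. ennreal (q (C i)) = 0) sequentially"
      unfolding eventually_sequentially
    proof (intro exI allI impI)
      fix i assume "n \<le> i"
      then have "C i = {}" using C(2) n by (auto simp: decseq_def)
      then show "ennreal (q (C i)) = 0" by (simp add: qe)
    qed
    then show "(\<lambda>i. ennreal (q (C i))) \<longlonglongrightarrow> 0" by (rule tendsto_eventually)
  qed auto
  then obtain m where m: "\<And>s. s \<in> clopens \<Longrightarrow> m s = ennreal (q s)"
    "measure_space X (sigma_sets X clopens) m" by blast
  define \<mu> where "\<mu> = measure_of X clopens m"
  have sets: "sets \<mu> = sigma_sets X clopens"
    unfolding \<mu>_def by (rule sets_measure_of) (auto simp: clopens_def)
  have space: "space \<mu> = X"
    unfolding \<mu>_def by (rule space_measure_of) (auto simp: clopens_def)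
  have em: "emeasure \<mu> s = ennreal (q s)" if "s \<in> clopens" for s
  proof -
    have "emeasure \<mu> s = m s"
    proof (rule emeasure_measure_of[OF \<mu>_def])
      show "clopens \<subseteq> Pow X" using clopens_subset by blast
      show "positive (sets \<mu>) m" "countably_additive (sets \<mu>) m"
        using m(2) by (simp_all add: sets measure_space_def)
      show "s \<in> sets \<mu>" using that by (auto simp: sets)
    qed
    then show ?thesis using m(1)[OF that] by simp
  qed
  have meas: "seq_shift \<in> measurable \<mu> \<mu>"
  proof (rule measurable_sigma_sets[OF sets])
    show "clopens \<subseteq> Pow X" using clopens_subset by blast
    show "seq_shift \<in> space \<mu> \<rightarrow> X" by (auto simp: space seq_shift_eq_sh)
    fix y assume y: "y \<in> clopens"
    have "seq_shift -` y \<inter> space \<mu> = sh 1 -` y"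
      using clopens_subset[OF y] by (auto simp: space seq_shift_eq_sh)
    then show "seq_shift -` y \<inter> space \<mu> \<in> sets \<mu>"
      using clopens_vimage_sh[OF y] by (auto simp: sets)
  qed
  \<comment> \<open>The mean is invariant on clopen sets; these form an intersection-stable
    generator, so invariance passes to all Borel sets.\<close>
  have "distr \<mu> \<mu> seq_shift = \<mu>"
  proof (rule measure_eqI_generator_eq[where E = clopens and \<Omega> = X and A = "\<lambda>_. X"])
    show "Int_stable clopens" using clopens_Int by (auto simp: Int_stable_def)
    show "clopens \<subseteq> Pow X" using clopens_subset by blast
    fix U assume U: "U \<in> clopens"
    have "seq_shift -` U \<inter> space \<mu> = sh 1 -` U"
      using clopens_subset[OF U] by (auto simp: space seq_shift_eq_sh)
    then have "emeasure (distr \<mu> \<mu> seq_shift) U = emeasure \<mu> (sh 1 -` U)"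
      using U by (subst emeasure_distr[OF meas]) (auto simp: sets)
    also have "\<dots> = ennreal (q (seq_shift -` U))"
      using em[OF clopens_vimage_sh[OF U]] by (simp add: seq_shift_eq_sh)
    also have "\<dots> = emeasure \<mu> U" using em[OF U] qinv by simp
    finally show "emeasure (distr \<mu> \<mu> seq_shift) U = emeasure \<mu> U" .
  next
    show "range (\<lambda>_. X) \<subseteq> clopens" using clopens_space by auto
    show "emeasure (distr \<mu> \<mu> seq_shift) X \<noteq> \<infinity>"
    proof -
      have "emeasure (distr \<mu> \<mu> seq_shift) X = emeasure \<mu> (seq_shift -` X \<inter> space \<mu>)"
        by (rule emeasure_distr[OF meas]) (auto simp: sets intro: clopens_space)
      also have "seq_shift -` X \<inter> space \<mu> = X" by (auto simp: space seq_shift_eq_sh)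
      finally show ?thesis using em[OF clopens_space] by simp
    qed
  qed (simp_all add: sets)
  then have inv: "emeasure \<mu> (seq_shift -` B \<inter> X) = emeasure \<mu> B" if "B \<in> sets \<mu>" for B
    using emeasure_distr[OF meas that] space by simp
  have "prob_space \<mu>"
    by (rule prob_spaceI) (simp add: space em[OF clopens_space] qX)
  moreover have "sets \<mu> = sets (sigma X {U. openin T U})"
    unfolding sets sigma_sets_clopens
    by (rule sets_measure_of[symmetric]) (auto simp: openin_T)
  ultimately show ?thesis unfolding invariant_prob_def using inv by blast
qed

section \<open>The invariant measure under the full group\<close>

definition inv_measure :: "(int \<Rightarrow> 'a) measure" where
  "inv_measure = (SOME \<mu>. invariant_prob A X \<mu>)"

lemma inv_measure: "invariant_prob A X inv_measure"
  unfolding inv_measure_def using invariant_prob_exists by (rule someI_ex)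

lemma prob_inv_measure: "prob_space inv_measure"
  using inv_measure by (simp add: invariant_prob_def)

lemma sets_inv_measure: "sets inv_measure = sigma_sets X clopens"
proof -
  have "sets inv_measure = sets (sigma X {U. openin T U})"
    using inv_measure by (simp add: invariant_prob_def)
  also have "\<dots> = sigma_sets X {U. openin T U}"
    by (rule sets_measure_of) (auto simp: openin_T)
  finally show ?thesis by (simp add: sigma_sets_clopens)
qed

lemma space_inv_measure [simp]: "space inv_measure = X"
proof -
  have "space (sigma X clopens) = X" "sets (sigma X clopens) = sigma_sets X clopens"
    using clopens_subset by (auto intro!: space_measure_of sets_measure_of)
  then show ?thesis using sets_eq_imp_space_eq[of inv_measure "sigma X clopens"] sets_inv_measure
    by simp
qed

lemma clopens_sets: "U \<in> clopens \<Longrightarrow> U \<in> sets inv_measure"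
  by (auto simp: sets_inv_measure)

lemma local_vimage_clopen: "local_on X K f \<Longrightarrow> f -` B \<inter> X \<in> clopens"
  by (rule clopensI[where K = K]) (auto dest: local_onD)

lemma local_measurable:
  "local_on X K f \<Longrightarrow> f \<in> X \<rightarrow> space N \<Longrightarrow> f \<in> measurable inv_measure N"
  by (rule measurableI) (auto intro: clopens_sets local_vimage_clopen)

lemma local_compose: "local_on X K f \<Longrightarrow> local_on X K (\<lambda>x. g (f x))"
  unfolding local_on_def by metis

lemma local_integrable:
  fixes n :: "(int \<Rightarrow> 'a) \<Rightarrow> int"
  assumes "local_on X K n"
  shows "integrable inv_measure (\<lambda>x. real_of_int (n x))"
proof -
  interpret prob_space inv_measure by (rule prob_inv_measure)
  obtain b where "\<And>x. x\<in>X \<Longrightarrow> \<bar>n x\<bar> \<le> int b" using local_imp_bounded[OF assms] by blast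
  then have b: "\<bar>real_of_int (n x)\<bar> \<le> real b" if "x \<in> X" for x
    using that by (metis of_int_abs of_int_le_iff of_int_of_nat_eq)
  show ?thesis
    using b by (intro integrable_const_bound[where B = "real b"] AE_I2
      local_measurable[OF local_compose[OF assms]]) auto
qed

lemma measure_vimage_sh:
  assumes "U \<in> clopens"
  shows "measure inv_measure (sh k -` U) = measure inv_measure U"
proof -
  have 1: "measure inv_measure (sh 1 -` U) = measure inv_measure U" if "U \<in> clopens" for U
  proof -
    have "seq_shift -` U \<inter> X = sh 1 -` U"
      using clopens_subset[OF that] by (auto simp: seq_shift_eq_sh)
    then show ?thesis using inv_measure clopens_sets[OF that]
      unfolding invariant_prob_def measure_def by metis
  qed
  have p: "measure inv_measure (sh (int n) -` U) = measure inv_measure U" if "U \<in> clopens" for n U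
  proof (induction n)
    case (Suc n)
    have "sh (int (Suc n)) -` U = sh 1 -` (sh (int n) -` U)" by (auto simp: add.commute)
    then show ?case using 1[OF clopens_vimage_sh[OF that]] Suc by simp
  qed (simp add: vimage_def)
  show ?thesis
  proof (cases k rule: int_cases2)
    case (nonneg n)
    then show ?thesis using p[OF assms] by simp
  next
    case (nonpos n)
    have "sh (int n) -` (sh k -` U) = U" using nonpos by auto
    then show ?thesis using p[OF clopens_vimage_sh[OF assms], of n k] by simp
  qed
qed

lemma clopens_finite_Union: "finite I \<Longrightarrow> (\<And>i. i \<in> I \<Longrightarrow> U i \<in> clopens) \<Longrightarrow> (\<Union>i\<in>I. U i) \<in> clopens"
  by (induction I rule: finite_induct) (auto intro: clopens_empty clopens_Un)

lemma FG_vimage_decomp: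
  assumes "\<gamma> \<in> FG" "\<And>x. x\<in>X \<Longrightarrow> \<bar>coc \<gamma> x\<bar> \<le> int b"
  shows "\<gamma> -` U \<inter> X = (\<Union>k\<in>{- int b..int b}. (coc \<gamma> -` {k} \<inter> X) \<inter> sh k -` U)"
proof -
  have "x \<in> \<gamma> -` U \<inter> X \<longleftrightarrow> x \<in> (\<Union>k\<in>{- int b..int b}. (coc \<gamma> -` {k} \<inter> X) \<inter> sh k -` U)" for x
  proof (cases "x \<in> X")
    case True
    have "coc \<gamma> x \<in> {- int b..int b}" using assms(2)[OF True] by auto
    then show ?thesis using FG_coc[OF assms(1) True] True by auto
  qed auto
  then show ?thesis by blast
qed

lemma FG_vimage_clopen:
  assumes "\<gamma> \<in> FG" "U \<in> clopens"
  shows "\<gamma> -` U \<inter> X \<in> clopens"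
proof -
  obtain K where K: "local_on X K (coc \<gamma>)" using FG_local assms by blast
  obtain b where b: "\<And>x. x\<in>X \<Longrightarrow> \<bar>coc \<gamma> x\<bar> \<le> int b" using local_imp_bounded[OF K] by blast
  have "\<gamma> -` U \<inter> X = (\<Union>k\<in>{- int b..int b}. (coc \<gamma> -` {k} \<inter> X) \<inter> sh k -` U)"
    by (rule FG_vimage_decomp[OF assms(1) b])
  also have "\<dots> \<in> clopens"
    by (intro clopens_finite_Union clopens_Int clopens_vimage_sh assms(2) local_vimage_clopen[OF K]) auto
  finally show ?thesis .
qed

text \<open>On each of the finitely many sets of constant displacement the map is a power of the
  shift, which preserves the measure. The pieces \<open>?E k\<close> partition the preimage, and
  their images \<open>?F k\<close> partition \<open>U\<close> because \<open>\<gamma>\<close> is a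
  bijection.\<close>

lemma measure_vimage_FG:
  assumes "\<gamma> \<in> FG" "U \<in> clopens"
  shows "measure inv_measure (\<gamma> -` U \<inter> X) = measure inv_measure U"
proof -
  interpret prob_space inv_measure by (rule prob_inv_measure)
  obtain K where K: "local_on X K (coc \<gamma>)" using FG_local assms by blast
  obtain b where b: "\<And>x. x\<in>X \<Longrightarrow> \<bar>coc \<gamma> x\<bar> \<le> int b" using local_imp_bounded[OF K] by blast
  let ?J = "{- int b..int b}"
  let ?P = "\<lambda>k. coc \<gamma> -` {k} \<inter> X"
  let ?E = "\<lambda>k. ?P k \<inter> sh k -` U"
  let ?F = "\<lambda>k. sh (- k) -` ?P k \<inter> U"
  have P: "?P k \<in> clopens" for k by (rule local_vimage_clopen[OF K])
  have E: "?E k \<in> clopens" for k by (intro clopens_Int P clopens_vimage_sh assms)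
  have F: "?F k \<in> clopens" for k by (intro clopens_Int P clopens_vimage_sh assms)
  have EF: "?E k = sh k -` ?F k" for k by auto
  have UE: "\<gamma> -` U \<inter> X = (\<Union>k\<in>?J. ?E k)" by (rule FG_vimage_decomp[OF assms(1) b])
  have inj: "inj_on \<gamma> X" and im: "\<gamma> ` X = X" using FG_bij[OF assms(1)] by (auto simp: bij_betw_def)
  have Fg: "\<gamma> (sh (-k) y) = y" if "y \<in> ?F k" for k :: int and y
    using FG_coc[OF assms(1), of "sh (-k) y"] that by auto
  have UF: "U = (\<Union>k\<in>?J. ?F k)"
  proof
    show "U \<subseteq> (\<Union>k\<in>?J. ?F k)"
    proof
      fix y assume y: "y \<in> U"
      then have "y \<in> \<gamma> ` X" using im clopens_subset[OF assms(2)] by blast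
      then obtain x where x: "x \<in> X" "y = \<gamma> x" by blast
      then have "x = sh (- coc \<gamma> x) y" using FG_coc[OF assms(1) x(1)] by simp
      then have "y \<in> ?F (coc \<gamma> x)" using x y by simp
      moreover have "coc \<gamma> x \<in> ?J" using b[OF x(1)] by auto
      ultimately show "y \<in> (\<Union>k\<in>?J. ?F k)" by blast
    qed
  qed auto
  have "measure inv_measure (\<gamma> -` U \<inter> X) = (\<Sum>k\<in>?J. measure inv_measure (?E k))"
    unfolding UE using E
    by (intro finite_measure_finite_Union) (auto simp: disjoint_family_on_def clopens_sets)
  also have "\<dots> = (\<Sum>k\<in>?J. measure inv_measure (?F k))"
    unfolding EF using measure_vimage_sh[OF F] by simp
  also have "\<dots> = measure inv_measure (\<Union>k\<in>?J. ?F k)"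
  proof (intro finite_measure_finite_Union[symmetric])
    show "disjoint_family_on ?F ?J"
      unfolding disjoint_family_on_def
    proof (intro ballI impI)
      fix k l :: int assume "k \<noteq> l"
      have False if "y \<in> ?F k" "y \<in> ?F l" for y
      proof -
        have "\<gamma> (sh (-k) y) = \<gamma> (sh (-l) y)" using Fg[OF that(1)] Fg[OF that(2)] by simp
        then have "sh (-k) y = sh (-l) y" using inj that by (auto dest: inj_onD)
        then show False using \<open>k \<noteq> l\<close> that sh_inj[of y "-k" "-l"] by auto
      qed
      then show "?F k \<inter> ?F l = {}" by blast
    qed
  qed (use F in \<open>auto simp: clopens_sets\<close>)
  finally show ?thesis using UF by simp
qed

lemma distr_FG:
  assumes "\<gamma> \<in> FG"
  shows "\<gamma> \<in> measurable inv_measure inv_measure" "distr inv_measure inv_measure \<gamma> = inv_measure"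
proof -
  interpret prob_space inv_measure by (rule prob_inv_measure)
  show meas: "\<gamma> \<in> measurable inv_measure inv_measure"
    using FG_mem[OF assms] clopens_sets[OF FG_vimage_clopen[OF assms]] clopens_subset
    by (intro measurable_sigma_sets[OF sets_inv_measure]) auto
  show "distr inv_measure inv_measure \<gamma> = inv_measure"
  proof (rule measure_eqI_generator_eq[where E = clopens and \<Omega> = X and A = "\<lambda>_. X"])
    show "Int_stable clopens" using clopens_Int by (auto simp: Int_stable_def)
    show "clopens \<subseteq> Pow X" using clopens_subset by blast
    fix U assume U: "U \<in> clopens"
    show "emeasure (distr inv_measure inv_measure \<gamma>) U = emeasure inv_measure U"
      using emeasure_distr[OF meas clopens_sets[OF U]] measure_vimage_FG[OF assms U]
      by (simp add: emeasure_eq_measure)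
  next
    show "range (\<lambda>_. X) \<subseteq> clopens" using clopens_space by auto
    interpret d: prob_space "distr inv_measure inv_measure \<gamma>" by (rule prob_space_distr[OF meas])
    show "emeasure (distr inv_measure inv_measure \<gamma>) X \<noteq> \<infinity>" by simp
  qed (simp_all add: sets_inv_measure)
qed

text \<open>The cocycle picked by \<open>SOME\<close> is determined only on \<open>X\<close>, but
  that is the whole space of the measure.\<close>

lemma index_map_eq:
  assumes "\<gamma> \<in> FG"
  shows "index_map A X \<gamma> = (\<integral>x. real_of_int (coc \<gamma> x) \<partial>inv_measure)"
proof -
  have "is_cocycle A X \<gamma> (SOME n. is_cocycle A X \<gamma> n)"
    using FG_is_cocycle[OF assms] by (rule someI[of "is_cocycle A X \<gamma>"])
  then show ?thesis
    unfolding index_map_def inv_measure_def[symmetric]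
    by (intro Bochner_Integration.integral_cong) (auto simp: is_cocycle_coc)
qed

text \<open>Integrate the cocycle identity \<open>coc_compose\<close>; invariance of the measure
  under \<open>\<delta>\<close> removes the inner \<open>\<delta>\<close>.\<close>

lemma index_map_compose:
  assumes "\<gamma> \<in> FG" "\<delta> \<in> FG"
  shows "index_map A X (compose X \<gamma> \<delta>) = index_map A X \<gamma> + index_map A X \<delta>"
proof -
  obtain K where K: "local_on X K (coc \<gamma>)" using FG_local assms by blast
  obtain L where L: "local_on X L (coc \<delta>)" using FG_local assms by blast
  let ?g = "\<lambda>x. real_of_int (coc \<gamma> x)"
  note ig = local_integrable[OF K] and id = local_integrable[OF L]
  have d: "(\<integral>x. ?g (\<delta> x) \<partial>inv_measure) = (\<integral>x. ?g x \<partial>inv_measure)"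
    using integral_distr[OF distr_FG(1)[OF assms(2)], of ?g] ig by (simp add: distr_FG[OF assms(2)])
  have i: "integrable inv_measure (\<lambda>x. ?g (\<delta> x))"
    using integrable_distr[OF distr_FG(1)[OF assms(2)], of ?g] ig by (simp add: distr_FG[OF assms(2)])
  have "index_map A X (compose X \<gamma> \<delta>) = (\<integral>x. ?g (\<delta> x) + real_of_int (coc \<delta> x) \<partial>inv_measure)"
    unfolding index_map_eq[OF compose_FG[OF assms]]
    by (intro Bochner_Integration.integral_cong) (auto simp: coc_compose assms)
  also have "\<dots> = (\<integral>x. ?g (\<delta> x) \<partial>inv_measure) + (\<integral>x. real_of_int (coc \<delta> x) \<partial>inv_measure)"
    by (rule Bochner_Integration.integral_add[OF i id])
  finally show ?thesis using d assms by (simp add: index_map_eq)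
qed

section \<open>The kernel of the index map and its commutator subgroup\<close>

definition HG :: "((int \<Rightarrow> 'a) \<Rightarrow> (int \<Rightarrow> 'a)) set" where
  "HG = {\<gamma> \<in> FG. index_map A X \<gamma> = 0}"

lemma full_group_0_eq: "full_group_0 A X = BijGroup X \<lparr>carrier := HG\<rparr>"
  unfolding full_group_0_def full_group_eq HG_def by simp

lemma index_map_id: "index_map A X (\<lambda>x\<in>X. x) = 0"
  using index_map_compose[OF id_FG id_FG] by simp

text \<open>Twice the index of \<open>\<gamma>\<close> is 0, and the index is a real number.
  Elements of the kernel are recognised in this way without computing an integral.\<close>

lemma HG_involution:
  assumes "\<gamma> \<in> FG" "compose X \<gamma> \<gamma> = (\<lambda>x\<in>X. x)"
  shows "\<gamma> \<in> HG"
  using index_map_compose[OF assms(1,1)] assms index_map_id by (simp add: HG_def)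

lemma subgroup_HG: "subgroup HG (BijGroup X)"
proof (rule subgroup.intro)
  show "HG \<subseteq> carrier (BijGroup X)" by (auto simp: BijGroup_def HG_def FG_Bij)
  show "x \<otimes>\<^bsub>BijGroup X\<^esub> y \<in> HG" if "x \<in> HG" "y \<in> HG" for x y
    using that by (simp add: HG_def BijGroup_def FG_Bij compose_FG index_map_compose)
  show "\<one>\<^bsub>BijGroup X\<^esub> \<in> HG" by (simp add: HG_def BijGroup_def id_FG index_map_id)
  show "inv\<^bsub>BijGroup X\<^esub> x \<in> HG" if "x \<in> HG" for x
  proof -
    have x: "x \<in> FG" "index_map A X x = 0" using that by (auto simp: HG_def)
    have "index_map A X (compose X (\<lambda>y\<in>X. inv_into X x y) x) = 0"
      using Bij_compose_restrict_eq[OF FG_Bij[OF x(1)]] index_map_id by simp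
    then have "index_map A X (\<lambda>y\<in>X. inv_into X x y) = 0"
      using index_map_compose[OF inv_FG[OF x(1)] x(1)] x(2) by simp
    then show ?thesis using inv_FG[OF x(1)] by (simp add: HG_def inv_BijGroup[OF FG_Bij[OF x(1)]])
  qed
qed

definition DG :: "((int \<Rightarrow> 'a) \<Rightarrow> (int \<Rightarrow> 'a)) set" where
  "DG = derived (BijGroup X) HG"

lemma subgroup_DG: "subgroup DG (BijGroup X)"
  unfolding DG_def
  by (rule group.derived_is_subgroup[OF group_BijGroup subgroup.subset[OF subgroup_HG]])

text \<open>Commutators formed in a subgroup are those of the ambient group, so later computations
  can take place in \<open>BijGroup X\<close>.\<close>

lemma commutator_subgroup_eq:
  "commutator_subgroup (full_group_0 A X) = BijGroup X \<lparr>carrier := DG\<rparr>"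
proof -
  have "derived (BijGroup X \<lparr>carrier := HG\<rparr>) HG = DG"
    unfolding DG_def by (rule group.derived_consistent[OF group_BijGroup _ subgroup_HG]) simp
  then show ?thesis unfolding commutator_subgroup_def full_group_0_eq by simp
qed

lemma DG_FG: "DG \<subseteq> FG"
  using group.derived_incl[OF group_BijGroup _ subgroup_HG, of HG] unfolding DG_def HG_def by auto

lemma commutator_in_DG:
  assumes "g \<in> HG" "h \<in> HG"
  shows "g \<otimes>\<^bsub>BijGroup X\<^esub> h \<otimes>\<^bsub>BijGroup X\<^esub> inv\<^bsub>BijGroup X\<^esub> g \<otimes>\<^bsub>BijGroup X\<^esub> inv\<^bsub>BijGroup X\<^esub> h \<in> DG"
  unfolding DG_def derived_def using assms by (intro generate.incl) blast

end

section \<open>Towers and 3-cycles\<close>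

definition cyc :: "int \<Rightarrow> int \<Rightarrow> int \<Rightarrow> int \<Rightarrow> int" where
  "cyc a b c = (\<lambda>i. if i = a then b else if i = b then c else if i = c then a else i)"

lemma transpose_bij: "a \<in> J \<Longrightarrow> b \<in> J \<Longrightarrow> bij_betw (Transposition.transpose a b) J J"
  by (rule bij_betw_byWitness[where f' = "Transposition.transpose a b"]) (auto simp: Transposition.transpose_def)

text \<open>Transpositions are their own inverses, so the left-hand side is a group
  commutator.\<close>

lemma cyc_commutator:
  assumes "a \<noteq> b" "b \<noteq> c" "a \<noteq> c"
  shows "Transposition.transpose a c \<circ> Transposition.transpose c b \<circ> Transposition.transpose a c \<circ> Transposition.transpose c b = cyc a b c"
  using assms by (auto simp: fun_eq_iff cyc_def Transposition.transpose_def)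

lemma cyc_inverse:
  assumes "a \<noteq> b" "b \<noteq> c" "a \<noteq> c"
  shows "cyc a c b \<circ> cyc a b c = id"
  using assms by (auto simp: fun_eq_iff cyc_def)

lemma cyc_rotate:
  assumes "a \<noteq> b" "b \<noteq> c" "a \<noteq> c"
  shows "cyc a b c = cyc b c a"
  using assms by (auto simp: fun_eq_iff cyc_def)

text \<open>\<open>cyc c e d\<close> inverts \<open>cyc c d e\<close>, so this is a conjugation,
  renaming \<open>c\<close> to \<open>d\<close>. The spare letter \<open>e\<close> allows the
  conjugating element to be a 3-cycle too.\<close>

lemma cyc_conj:
  assumes "distinct [a, b, c, d, e]"
  shows "cyc c d e \<circ> cyc a b c \<circ> cyc c e d = cyc a b d"
  using assms by (auto simp: fun_eq_iff cyc_def)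

text \<open>\<open>cyc a k b\<close> inverts \<open>cyc a b k\<close>, so this is a quotient of two
  3-cycles with the points \<open>a\<close> and \<open>b\<close> in common.\<close>

lemma cyc_div:
  assumes "distinct [a, b, k, l]"
  shows "cyc a k b \<circ> cyc a b l = cyc b l k"
  using assms by (auto simp: fun_eq_iff cyc_def)

context aperiodic_subshift
begin

text \<open>Disjointness of the levels, expressed over the base: the point above \<open>y\<close> on
  level \<open>i\<close> lies on level \<open>j\<close> as well exactly when
  \<open>sh (i - j) y\<close> is in \<open>W\<close>.\<close>

definition tower :: "int set \<Rightarrow> (int \<Rightarrow> 'a) set \<Rightarrow> bool" where
  "tower J W \<longleftrightarrow> finite J \<and> W \<in> clopens \<and>
    (\<forall>y i j. i \<in> J \<longrightarrow> j \<in> J \<longrightarrow> y \<in> W \<longrightarrow> sh (i - j) y \<in> W \<longrightarrow> i = j)"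

text \<open>The element \<open>lift J W \<pi>\<close> of the full group permutes the levels \<open>\<phi>\<^sup>i W\<close>, \<open>i \<in> J\<close>, in the way \<open>\<pi>\<close>
  permutes \<open>J\<close>; the description in \<open>level\<close> is only meaningful if they are disjoint (\<open>tower\<close>).\<close>

definition level :: "int set \<Rightarrow> (int \<Rightarrow> 'a) set \<Rightarrow> (int \<Rightarrow> 'a) \<Rightarrow> int" where
  "level J W x = (THE i. i \<in> J \<and> sh (- i) x \<in> W)"

definition jump :: "int set \<Rightarrow> (int \<Rightarrow> 'a) set \<Rightarrow> (int \<Rightarrow> int) \<Rightarrow> (int \<Rightarrow> 'a) \<Rightarrow> int" where
  "jump J W \<pi> x = (if \<exists>i\<in>J. sh (- i) x \<in> W then \<pi> (level J W x) - level J W x else 0)"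

definition lift :: "int set \<Rightarrow> (int \<Rightarrow> 'a) set \<Rightarrow> (int \<Rightarrow> int) \<Rightarrow> (int \<Rightarrow> 'a) \<Rightarrow> (int \<Rightarrow> 'a)" where
  "lift J W \<pi> = (\<lambda>x\<in>X. sh (jump J W \<pi> x) x)"

lemma tower_unique:
  assumes "tower J W" "i \<in> J" "j \<in> J" "sh (- i) x \<in> W" "sh (- j) x \<in> W"
  shows "i = j"
  using assms(1)[unfolded tower_def, THEN conjunct2, THEN conjunct2, rule_format,
      OF assms(2,3,4)] assms(5) by simp

lemma jump_on:
  assumes "tower J W" "i \<in> J" "sh (- i) x \<in> W"
  shows "jump J W \<pi> x = \<pi> i - i"
proof -
  have "level J W x = i"
    unfolding level_def using assms tower_unique[OF assms(1)] by (intro the_equality) auto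
  then show ?thesis using assms by (auto simp: jump_def)
qed

lemma jump_off: "(\<And>i. i \<in> J \<Longrightarrow> sh (- i) x \<notin> W) \<Longrightarrow> jump J W \<pi> x = 0"
  by (auto simp: jump_def)

lemma lift_on:
  assumes "tower J W" "i \<in> J" "sh (- i) x \<in> W"
  shows "lift J W \<pi> x = sh (\<pi> i - i) x"
proof -
  have "W \<subseteq> X" using assms(1) by (simp add: tower_def clopens_subset)
  then have "x \<in> X" using assms(3) by auto
  then show ?thesis using jump_on[OF assms] by (simp add: lift_def)
qed

lemma lift_off: "x \<in> X \<Longrightarrow> (\<And>i. i \<in> J \<Longrightarrow> sh (- i) x \<notin> W) \<Longrightarrow> lift J W \<pi> x = x"
  by (simp add: lift_def jump_off)

lemma lift_extensional: "lift J W \<pi> \<in> extensional X"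
  by (simp add: lift_def)

lemma lift_mem: "x \<in> X \<Longrightarrow> lift J W \<pi> x \<in> X"
  by (simp add: lift_def)

lemma lift_id:
  assumes "tower J W"
  shows "lift J W id = (\<lambda>x\<in>X. x)"
proof (rule extensionalityI[OF lift_extensional restrict_extensional])
  fix x assume x: "x \<in> X"
  show "lift J W id x = (\<lambda>x\<in>X. x) x"
  proof (cases "\<exists>i\<in>J. sh (- i) x \<in> W")
    case True
    then show ?thesis using lift_on[OF assms, of _ x id] x by auto
  next
    case False
    then show ?thesis using lift_off[of x J W id] x by auto
  qed
qed

text \<open>The inner permutation must map \<open>J\<close> into itself, so that a moved point still
  lies on a level when the outer map is applied.\<close>

lemma lift_compose:
  assumes "tower J W" "\<And>i. i \<in> J \<Longrightarrow> \<sigma> i \<in> J"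
  shows "compose X (lift J W \<pi>) (lift J W \<sigma>) = lift J W (\<pi> \<circ> \<sigma>)"
proof (rule extensionalityI[OF compose_extensional lift_extensional])
  fix x assume x: "x \<in> X"
  show "compose X (lift J W \<pi>) (lift J W \<sigma>) x = lift J W (\<pi> \<circ> \<sigma>) x"
  proof (cases "\<exists>i\<in>J. sh (- i) x \<in> W")
    case True
    then obtain i where i: "i \<in> J" "sh (- i) x \<in> W" by blast
    have "lift J W \<sigma> x = sh (\<sigma> i - i) x" by (rule lift_on[OF assms(1) i])
    moreover have "lift J W \<pi> (sh (\<sigma> i - i) x) = sh (\<pi> (\<sigma> i) - \<sigma> i) (sh (\<sigma> i - i) x)"
      using i by (intro lift_on[OF assms(1) assms(2)[OF i(1)]]) simp
    moreover have "lift J W (\<pi> \<circ> \<sigma>) x = sh ((\<pi> \<circ> \<sigma>) i - i) x" by (rule lift_on[OF assms(1) i])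
    ultimately show ?thesis using x by (simp add: compose_def)
  next
    case False
    then show ?thesis using lift_off[of x J W] x by (simp add: compose_def)
  qed
qed

lemma lift_Bij:
  assumes "tower J W" "bij_betw \<pi> J J"
  shows "lift J W \<pi> \<in> Bij X"
proof -
  define \<rho> where "\<rho> i = (if i \<in> J then inv_into J \<pi> i else i)" for i
  have \<rho>: "\<rho> i \<in> J" if "i \<in> J" for i
    using assms(2) that by (simp add: \<rho>_def bij_betw_def inv_into_into)
  have \<pi>: "\<pi> i \<in> J" if "i \<in> J" for i using assms(2) that bij_betwE by blast
  have 1: "lift J W (\<pi> \<circ> \<rho>) = lift J W id" "lift J W (\<rho> \<circ> \<pi>) = lift J W id"
  proof -
    \<comment> \<open>A lift sees the permutation only on \<open>J\<close>, and there
      \<open>\<pi>\<close> and \<open>\<rho>\<close> are mutually inverse.\<close>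
    have e: "lift J W \<alpha> = lift J W id" if "\<And>i. i \<in> J \<Longrightarrow> \<alpha> i = i" for \<alpha>
    proof (rule extensionalityI[OF lift_extensional lift_extensional])
      fix x assume x: "x \<in> X"
      show "lift J W \<alpha> x = lift J W id x"
      proof (cases "\<exists>i\<in>J. sh (- i) x \<in> W")
        case True
        then obtain i where i: "i \<in> J" "sh (- i) x \<in> W" by blast
        show ?thesis using lift_on[OF assms(1) i, of \<alpha>] lift_on[OF assms(1) i, of id] that[OF i(1)] by simp
      next
        case False
        then show ?thesis using lift_off[of x J W] x by simp
      qed
    qed
    show "lift J W (\<pi> \<circ> \<rho>) = lift J W id"
      using assms(2) by (intro e) (auto simp: \<rho>_def bij_betw_def f_inv_into_f)
    show "lift J W (\<rho> \<circ> \<pi>) = lift J W id"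
      using assms(2) \<pi> by (intro e) (auto simp: \<rho>_def bij_betw_def)
  qed
  have 2: "lift J W \<pi> (lift J W \<rho> x) = x" "lift J W \<rho> (lift J W \<pi> x) = x" if "x \<in> X" for x
    using fun_cong[OF lift_compose[OF assms(1), of \<rho> \<pi>], of x]
      fun_cong[OF lift_compose[OF assms(1), of \<pi> \<rho>], of x] \<pi> \<rho> 1 that lift_id[OF assms(1)]
    by (simp_all add: compose_def)
  have "bij_betw (lift J W \<pi>) X X"
    by (rule bij_betw_byWitness[where f' = "lift J W \<rho>"]) (use 2 lift_mem in auto)
  then show ?thesis using lift_extensional by (simp add: Bij_def)
qed

lemma lift_FG:
  assumes "tower J W" "bij_betw \<pi> J J"
  shows "lift J W \<pi> \<in> FG"
proof -
  have J: "finite J" and W: "W \<in> clopens" using assms by (auto simp: tower_def)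
  obtain K where K: "\<And>x y. x \<in> W \<Longrightarrow> y \<in> X \<Longrightarrow> agree K x y \<Longrightarrow> y \<in> W" using W by (metis clopensE)
  \<comment> \<open>The \<open>(K + M)\<close>-window of \<open>x\<close> shows the
    \<open>K\<close>-window of \<open>sh (- i) x\<close> for every \<open>i\<close> in
    \<open>J\<close>, so it decides on which level \<open>x\<close> lies.\<close>
  define M where "M = nat (Max (insert 0 (abs ` J)))"
  have M: "nat \<bar>i\<bar> \<le> M" if "i \<in> J" for i
  proof -
    have "\<bar>i\<bar> \<le> Max (insert 0 (abs ` J))" using J that by (intro Max_ge) auto
    then show ?thesis unfolding M_def by linarith
  qed
  have lev: "sh (- i) y \<in> W" if "agree (K + M) x y" "y \<in> X" "i \<in> J" "sh (- i) x \<in> W" for x y i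
    by (rule K[OF that(4)]) (use that M[OF that(3)] in \<open>auto intro: agree_sh\<close>)
  have "local_on X (K + M) (jump J W \<pi>)"
    unfolding local_on_def
  proof (intro ballI impI)
    fix x y assume xy: "x \<in> X" "y \<in> X" "agree (K + M) x y"
    show "jump J W \<pi> x = jump J W \<pi> y"
    proof (cases "\<exists>i\<in>J. sh (- i) x \<in> W")
      case True
      then obtain i where i: "i \<in> J" "sh (- i) x \<in> W" by blast
      show ?thesis using jump_on[OF assms(1) i] jump_on[OF assms(1) i(1) lev[OF xy(3,2) i]] by simp
    next
      case False
      then have "\<And>i. i \<in> J \<Longrightarrow> sh (- i) y \<notin> W" using lev[OF agree_sym[OF xy(3)] xy(1)] by blast
      then show ?thesis using False by (simp add: jump_off)
    qed
  qed
  then show ?thesis by (rule FG_I[OF lift_Bij[OF assms], rotated]) (simp add: lift_def)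
qed

lemma lift_transpose_HG:
  assumes "tower J W" "a \<in> J" "b \<in> J"
  shows "lift J W (Transposition.transpose a b) \<in> HG"
proof (rule HG_involution)
  show "lift J W (Transposition.transpose a b) \<in> FG" using lift_FG[OF assms(1) transpose_bij[OF assms(2,3)]] .
  show "compose X (lift J W (Transposition.transpose a b)) (lift J W (Transposition.transpose a b)) = (\<lambda>x\<in>X. x)"
    using assms by (subst lift_compose) (auto simp: lift_id Transposition.transpose_def)
qed

lemma Bij_mult: "f \<in> Bij X \<Longrightarrow> g \<in> Bij X \<Longrightarrow> f \<otimes>\<^bsub>BijGroup X\<^esub> g = compose X f g"
  by (simp add: BijGroup_def)

text \<open>Lifting \<open>cyc_commutator\<close> gives a commutator of two lifted transpositions,
  which lie in the kernel of the index map.\<close>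

lemma lift_cyc_DG:
  assumes t: "tower J W" and J: "a \<in> J" "b \<in> J" "c \<in> J" and d: "a \<noteq> b" "b \<noteq> c" "a \<noteq> c"
  shows "lift J W (cyc a b c) \<in> DG"
proof -
  interpret B: group "BijGroup X" by (rule group_BijGroup)
  let ?s = "lift J W (Transposition.transpose a c)" and ?t = "lift J W (Transposition.transpose c b)"
  have H: "?s \<in> HG" "?t \<in> HG" using lift_transpose_HG[OF t] J by auto
  have Bij: "?s \<in> Bij X" "?t \<in> Bij X" using H by (auto simp: HG_def FG_Bij)
  have inv: "inv\<^bsub>BijGroup X\<^esub> (lift J W (Transposition.transpose u v)) = lift J W (Transposition.transpose u v)" if "u \<in> J" "v \<in> J" for u v
  proof -
    have 1: "lift J W (Transposition.transpose u v) \<in> Bij X" using lift_transpose_HG[OF t that] by (auto simp: HG_def FG_Bij)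
    have "compose X (lift J W (Transposition.transpose u v)) (lift J W (Transposition.transpose u v)) = (\<lambda>x\<in>X. x)"
      using t that by (subst lift_compose) (auto simp: lift_id Transposition.transpose_def)
    then show ?thesis using 1 by (intro B.inv_equality) (auto simp: BijGroup_def)
  qed
  have tr: "Transposition.transpose u v i \<in> J" if "u \<in> J" "v \<in> J" "i \<in> J" for u v i using that by (auto simp: Transposition.transpose_def)
  have "?s \<otimes>\<^bsub>BijGroup X\<^esub> ?t \<otimes>\<^bsub>BijGroup X\<^esub> ?s \<otimes>\<^bsub>BijGroup X\<^esub> ?t
    = compose X (compose X (compose X ?s ?t) ?s) ?t"
    using Bij by (simp add: Bij_mult compose_Bij)
  also have "\<dots> = lift J W (Transposition.transpose a c \<circ> Transposition.transpose c b \<circ> Transposition.transpose a c \<circ> Transposition.transpose c b)"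
    using tr J by (simp add: lift_compose[OF t])
  also have "\<dots> = lift J W (cyc a b c)" using cyc_commutator[OF d] by simp
  finally show ?thesis using commutator_in_DG[OF H] inv J by simp
qed

lemma tower_subset: "tower J W \<Longrightarrow> V \<in> clopens \<Longrightarrow> V \<subseteq> W \<Longrightarrow> tower J V"
  unfolding tower_def by blast

lemma tower_mono: "tower J W \<Longrightarrow> I \<subseteq> J \<Longrightarrow> tower I W"
  unfolding tower_def by (auto intro: finite_subset)

text \<open>Levels fixed by the permutation are not moved, so a 3-cycle on levels 0, 1, 2 may be
  regarded as living in a tall tower over the same base.\<close>

lemma lift_mono:
  assumes "tower J W" "I \<subseteq> J" "\<And>i. i \<in> J - I \<Longrightarrow> \<pi> i = i"
  shows "lift I W \<pi> = lift J W \<pi>"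
proof (rule extensionalityI[OF lift_extensional lift_extensional])
  fix x assume x: "x \<in> X"
  note tI = tower_mono[OF assms(1,2)]
  show "lift I W \<pi> x = lift J W \<pi> x"
  proof (cases "\<exists>i\<in>J. sh (- i) x \<in> W")
    case True
    then obtain i where i: "i \<in> J" "sh (- i) x \<in> W" by blast
    have J: "lift J W \<pi> x = sh (\<pi> i - i) x" by (rule lift_on[OF assms(1) i])
    show ?thesis
    proof (cases "i \<in> I")
      case True then show ?thesis using lift_on[OF tI True i(2), of \<pi>] J by simp
    next
      case False
      then have "lift I W \<pi> x = x"
        using tower_unique[OF assms(1) i(1) _ i(2)] assms(2) by (intro lift_off[OF x]) blast
      then show ?thesis using J assms(3) i False by simp
    qed
  next
    case False
    then show ?thesis using lift_off[of x I W \<pi>] lift_off[of x J W \<pi>] x assms(2) by auto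
  qed
qed

text \<open>The factors have disjoint supports: a point above \<open>V\<close> is untouched by the
  lift over \<open>W\<close>, and a point above \<open>W\<close> stays above \<open>W\<close>. This
  is what cuts a 3-cycle into small ones.\<close>

lemma lift_Un:
  assumes "tower J (V \<union> W)" "tower J V" "tower J W" "V \<inter> W = {}" "\<And>i. i \<in> J \<Longrightarrow> \<pi> i \<in> J"
  shows "lift J (V \<union> W) \<pi> = compose X (lift J V \<pi>) (lift J W \<pi>)"
proof (rule extensionalityI[OF lift_extensional compose_extensional])
  fix x assume x: "x \<in> X"
  have nV: "sh (- j) y \<notin> V" if "i \<in> J" "j \<in> J" "sh (- i) y \<in> W" for i j y
    using tower_unique[OF assms(1) that(1,2), of y] that(3) assms(4) by blast
  have nW: "sh (- j) y \<notin> W" if "i \<in> J" "j \<in> J" "sh (- i) y \<in> V" for i j y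
    using tower_unique[OF assms(1) that(1,2), of y] that(3) assms(4) by blast
  consider i where "i \<in> J" "sh (- i) x \<in> V" | i where "i \<in> J" "sh (- i) x \<in> W"
    | "\<And>i. i \<in> J \<Longrightarrow> sh (- i) x \<notin> V \<union> W" by blast
  then show "lift J (V \<union> W) \<pi> x = compose X (lift J V \<pi>) (lift J W \<pi>) x"
  proof cases
    case 1
    have "lift J W \<pi> x = x" using nW[OF 1(1) _ 1(2)] by (intro lift_off[OF x])
    then show ?thesis
      using lift_on[OF assms(2) 1, of \<pi>] lift_on[OF assms(1) 1(1), of x \<pi>] 1 x by (simp add: compose_def)
  next
    case 2
    have a: "lift J W \<pi> x = sh (\<pi> i - i) x" for \<pi> by (rule lift_on[OF assms(3) 2])
    have W: "sh (- \<pi> i) (sh (\<pi> i - i) x) \<in> W" using 2 by simp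
    have "lift J V \<pi> (sh (\<pi> i - i) x) = sh (\<pi> i - i) x"
    proof (rule lift_off)
      show "sh (\<pi> i - i) x \<in> X" using x by simp
      show "sh (- j) (sh (\<pi> i - i) x) \<notin> V" if "j \<in> J" for j
        by (rule nV[OF assms(5)[OF 2(1)] that W])
    qed
    then show ?thesis
      using a lift_on[OF assms(1) 2(1), of x \<pi>] 2 x by (simp add: compose_def)
  next
    case 3
    then show ?thesis using lift_off[OF x] x by (simp add: compose_def)
  qed
qed

section \<open>Finite quotients of the commutator subgroup\<close>

abbreviation DGr :: "((int \<Rightarrow> 'a) \<Rightarrow> (int \<Rightarrow> 'a)) monoid" where
  "DGr \<equiv> BijGroup X \<lparr>carrier := DG\<rparr>"

lemma group_DGr: "group DGr"
  by (rule subgroup.subgroup_is_group[OF subgroup_DG group_BijGroup])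

lemma DG_Bij: "g \<in> DG \<Longrightarrow> g \<in> Bij X"
  using DG_FG FG_Bij by blast

lemma hom_lift:
  assumes "h \<in> hom DGr Q" "tower J W" "lift J W \<pi> \<in> DG" "lift J W \<sigma> \<in> DG" "\<And>i. i \<in> J \<Longrightarrow> \<sigma> i \<in> J"
  shows "h (lift J W (\<pi> \<circ> \<sigma>)) = h (lift J W \<pi>) \<otimes>\<^bsub>Q\<^esub> h (lift J W \<sigma>)"
proof -
  have "lift J W (\<pi> \<circ> \<sigma>) = lift J W \<pi> \<otimes>\<^bsub>DGr\<^esub> lift J W \<sigma>"
    using assms lift_compose[OF assms(2), of \<sigma> \<pi>] by (simp add: Bij_mult DG_Bij)
  then show ?thesis using assms(1,3,4) by (simp add: hom_def)
qed

text \<open>Among many 3-cycles sharing two points, two have the same image in a finite group; their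
  quotient is a 3-cycle in the kernel, and it is conjugate to every other 3-cycle.\<close>

lemma finite_quotient_kills_tall_tower:
  assumes Q: "group Q" "finite (carrier Q)" and h: "h \<in> hom DGr Q"
    and t: "tower {0..int (card (carrier Q)) + 5} W"
  shows "h (lift {0..int (card (carrier Q)) + 5} W (cyc 0 1 2)) = \<one>\<^bsub>Q\<^esub>"
proof -
  interpret Q: group Q by (rule Q(1))
  let ?J = "{0..int (card (carrier Q)) + 5}"
  define g where "g a b c = h (lift ?J W (cyc a b c))" for a b c
  have mem: "lift ?J W (cyc a b c) \<in> DG" if "a \<in> ?J" "b \<in> ?J" "c \<in> ?J" "distinct [a, b, c]" for a b c
    using that by (intro lift_cyc_DG[OF t]) auto
  have gQ: "g a b c \<in> carrier Q" if "a \<in> ?J" "b \<in> ?J" "c \<in> ?J" "distinct [a, b, c]" for a b c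
    using h mem[OF that] unfolding g_def by (auto simp: hom_def)
  have cJ: "cyc a b c i \<in> ?J" if "a \<in> ?J" "b \<in> ?J" "c \<in> ?J" "i \<in> ?J" for a b c i
    using that by (auto simp: cyc_def)
  have comp: "h (lift ?J W (cyc a b c \<circ> cyc a' b' c')) = g a b c \<otimes>\<^bsub>Q\<^esub> g a' b' c'"
    if "a \<in> ?J" "b \<in> ?J" "c \<in> ?J" "distinct [a, b, c]"
      "a' \<in> ?J" "b' \<in> ?J" "c' \<in> ?J" "distinct [a', b', c']" for a b c a' b' c'
    unfolding g_def using that cJ by (intro hom_lift[OF h t] mem) auto
  have hid: "h (lift ?J W id) = \<one>\<^bsub>Q\<^esub>"
    using hom_one[OF h group_DGr Q(1)] lift_id[OF t] by (simp add: BijGroup_def)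
  have inv: "g a c b \<otimes>\<^bsub>Q\<^esub> g a b c = \<one>\<^bsub>Q\<^esub>" if "a \<in> ?J" "b \<in> ?J" "c \<in> ?J" "distinct [a, b, c]" for a b c
    using comp[of a c b a b c] that hid cyc_inverse[of a b c] by auto
  have rot: "g a b c = g b c a" if "distinct [a, b, c]" for a b c
    unfolding g_def using cyc_rotate[of a b c] that by simp
  have conj: "g a b d = \<one>\<^bsub>Q\<^esub>" if "g a b c = \<one>\<^bsub>Q\<^esub>" "distinct [a, b, c, d, e]"
    "a \<in> ?J" "b \<in> ?J" "c \<in> ?J" "d \<in> ?J" "e \<in> ?J" for a b c d e
  proof -
    have dd: "lift ?J W (cyc c d e \<circ> cyc a b c) \<in> DG"
    proof -
      have "lift ?J W (cyc c d e \<circ> cyc a b c) = lift ?J W (cyc c d e) \<otimes>\<^bsub>BijGroup X\<^esub> lift ?J W (cyc a b c)"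
      proof -
        have "compose X (lift ?J W (cyc c d e)) (lift ?J W (cyc a b c)) = lift ?J W (cyc c d e \<circ> cyc a b c)"
          by (rule lift_compose[OF t]) (rule cJ[OF that(3,4,5)])
        then show ?thesis using that mem[of a b c] mem[of c d e] by (simp add: Bij_mult DG_Bij)
      qed
      then show ?thesis using subgroup.m_closed[OF subgroup_DG] mem that by simp
    qed
    have "g a b d = h (lift ?J W (cyc c d e \<circ> cyc a b c \<circ> cyc c e d))"
      unfolding g_def cyc_conj[OF that(2)] ..
    also have "\<dots> = h (lift ?J W (cyc c d e \<circ> cyc a b c)) \<otimes>\<^bsub>Q\<^esub> g c e d"
      unfolding g_def using that cJ mem by (intro hom_lift[OF h t] dd) auto
    also have "h (lift ?J W (cyc c d e \<circ> cyc a b c)) = g c d e \<otimes>\<^bsub>Q\<^esub> g a b c"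
      using that by (intro comp) auto
    also have "g c d e \<otimes>\<^bsub>Q\<^esub> g a b c \<otimes>\<^bsub>Q\<^esub> g c e d = g c d e \<otimes>\<^bsub>Q\<^esub> g c e d"
      using that gQ[of c d e] by simp
    also have "\<dots> = \<one>\<^bsub>Q\<^esub>" using inv[of c e d] that by auto
    finally show ?thesis .
  qed
  \<comment> \<open>From 5 upwards there are \<open>card (carrier Q) + 1\<close> third letters; 3
    and 4 are the common points, and 0, 1, 2 stay free for the target cycle.\<close>
  have "\<not> inj_on (\<lambda>k. g 3 4 k) {5..int (card (carrier Q)) + 5}"
  proof
    assume "inj_on (\<lambda>k. g 3 4 k) {5..int (card (carrier Q)) + 5}"
    then have "card {5..int (card (carrier Q)) + 5} \<le> card (carrier Q)"
      using gQ by (intro card_inj_on_le[OF _ _ Q(2)]) auto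
    then show False by simp
  qed
  then obtain k l where kl: "k \<in> {5..int (card (carrier Q)) + 5}" "l \<in> {5..int (card (carrier Q)) + 5}"
    "k \<noteq> l" "g 3 4 k = g 3 4 l" unfolding inj_on_def by blast
  have "g 4 l k = h (lift ?J W (cyc 3 k 4 \<circ> cyc 3 4 l))"
    unfolding g_def using kl by (subst cyc_div) auto
  also have "\<dots> = g 3 k 4 \<otimes>\<^bsub>Q\<^esub> g 3 4 l" using kl by (intro comp) auto
  also have "\<dots> = \<one>\<^bsub>Q\<^esub>" using inv[of 3 4 k] kl by simp
  \<comment> \<open>The kernel element is now changed letter by letter: \<open>conj\<close> replaces
    the last letter, \<open>rot\<close> brings the next one to the end, and 3 is spare throughout.
    The cycles are (4 l k), (4 l 0), (l 0 1), (0 1 2).\<close>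
  finally have "g 4 l 0 = \<one>\<^bsub>Q\<^esub>" using kl by (rule_tac conj[where c = k and e = 3]) auto
  then have "g l 0 4 = \<one>\<^bsub>Q\<^esub>" using rot[of 4 l 0] kl by simp
  then have "g l 0 1 = \<one>\<^bsub>Q\<^esub>" using kl by (rule_tac conj[where c = 4 and e = 3]) auto
  then have "g 0 1 l = \<one>\<^bsub>Q\<^esub>" using rot[of l 0 1] kl by simp
  then have "g 0 1 2 = \<one>\<^bsub>Q\<^esub>" using kl by (rule_tac conj[where c = l and e = 3]) auto
  then show ?thesis by (simp add: g_def)
qed

abbreviation three :: "(int \<Rightarrow> 'a) set \<Rightarrow> (int \<Rightarrow> 'a) \<Rightarrow> (int \<Rightarrow> 'a)" where
  "three W \<equiv> lift {0, 1, 2} W (cyc 0 1 2)"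

lemma three_DG: "tower {0, 1, 2} W \<Longrightarrow> three W \<in> DG"
  by (rule lift_cyc_DG) auto

text \<open>Two points of a cylinder share a window, so a return to the cylinder within
  \<open>N\<close> steps would contradict separation.\<close>

lemma tower_cyl:
  assumes "\<forall>x\<in>X. \<forall>d. d \<noteq> 0 \<and> \<bar>d\<bar> \<le> int N \<longrightarrow> \<not> agree K x (sh d x)" "J \<subseteq> {0..int N}"
  shows "tower J (cyl K x)"
  unfolding tower_def
proof (intro conjI allI impI)
  show "finite J" using assms(2) finite_subset by blast
  show "cyl K x \<in> clopens" by (rule cyl_clopen)
  fix y i j assume h: "i \<in> J" "j \<in> J" "y \<in> cyl K x" "sh (i - j) y \<in> cyl K x"
  have "agree K y (sh (i - j) y)"
    using h(3,4) agree_trans[OF agree_sym, of K x y] by (auto simp: cyl_def)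
  moreover have "i \<in> {0..int N}" "j \<in> {0..int N}" using h(1,2) assms(2) by blast+
  then have "\<bar>i - j\<bar> \<le> int N" by auto
  ultimately show "i = j"
    using assms(1)[rule_format, of y "i - j"] h(3) by (auto simp: cyl_def)
qed

lemma finite_quotient_kills:
  assumes Q: "group Q" "finite (carrier Q)" and h: "h \<in> hom DGr Q"
    and t: "tower {0, 1, 2} W"
  shows "h (three W) = \<one>\<^bsub>Q\<^esub>"
proof -
  interpret Q: group Q by (rule Q(1))
  \<comment> \<open>A tower with levels 0 to \<open>?N\<close> requires that return times up to
    \<open>?N\<close> be excluded. The set \<open>W\<close> may be too wide for this, but its
    intersections with \<open>K\<close>-cylinders are not.\<close>
  let ?N = "card (carrier Q) + 5"
  obtain K where K: "\<forall>x\<in>X. \<forall>d. d \<noteq> 0 \<and> \<bar>d\<bar> \<le> int ?N \<longrightarrow> \<not> agree K x (sh d x)"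
    using separation by blast
  have Wc: "W \<in> clopens" using t by (simp add: tower_def)
  have piece: "h (three (W \<inter> cyl K x)) = \<one>\<^bsub>Q\<^esub>" for x
  proof -
    have "tower {0..int ?N} (cyl K x)" by (rule tower_cyl[OF K]) simp
    then have T: "tower {0..int (card (carrier Q)) + 5} (W \<inter> cyl K x)"
      using tower_subset[of _ "cyl K x" "W \<inter> cyl K x"] clopens_Int[OF Wc cyl_clopen] by simp
    have "three (W \<inter> cyl K x) = lift {0..int (card (carrier Q)) + 5} (W \<inter> cyl K x) (cyc 0 1 2)"
      by (rule lift_mono[OF T]) (auto simp: cyc_def)
    then show ?thesis using finite_quotient_kills_tall_tower[OF Q h T] by simp
  qed
  have tsub: "tower {0,1,2} V" if "V \<in> clopens" "V \<subseteq> W" for V by (rule tower_subset[OF t that])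
  \<comment> \<open>Cylinders are added one at a time; clopenness is carried along because
    \<open>lift_Un\<close> needs a tower over the part already treated.\<close>
  have "h (three (W \<inter> \<Union>F)) = \<one>\<^bsub>Q\<^esub> \<and> W \<inter> \<Union>F \<in> clopens" if "finite F" "F \<subseteq> cyl K ` X" for F
    using that
  proof (induction F rule: finite_induct)
    case empty
    have "three {} = (\<lambda>x\<in>X. x)"
      by (rule extensionalityI[OF lift_extensional restrict_extensional]) (simp add: lift_off)
    then have "three {} = \<one>\<^bsub>DGr\<^esub>" unfolding BijGroup_def by simp
    then show ?case using hom_one[OF h group_DGr Q(1)] clopens_empty by (simp only: Sup_empty Int_empty_right)
  next
    case (insert C F)
    then obtain x where x: "x \<in> X" "C = cyl K x" by blast
    let ?V = "W \<inter> C" and ?U = "W \<inter> \<Union>F"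
    have Vc: "?V \<in> clopens" using clopens_Int[OF Wc cyl_clopen] x by simp
    have Uc: "?U \<in> clopens" and hU: "h (three ?U) = \<one>\<^bsub>Q\<^esub>" using insert by auto
    have eq: "W \<inter> \<Union>(insert C F) = ?V \<union> ?U" by blast
    have disj: "?V \<inter> ?U = {}"
    proof -
      have False if D: "y \<in> C" "D \<in> F" "y \<in> D" for y D
      proof -
        obtain z where "D = cyl K z" using insert.prems D(2) by blast
        then have "C = D" using cyl_eq[of y K x] cyl_eq[of y K z] x D by simp
        then show False using insert.hyps D by simp
      qed
      then show ?thesis by blast
    qed
    have tV: "tower {0,1,2} ?V" and tU: "tower {0,1,2} ?U" and tUV: "tower {0,1,2} (?V \<union> ?U)"
      using tsub Vc Uc clopens_Un[OF Vc Uc] by auto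
    have "three (?V \<union> ?U) = compose X (three ?V) (three ?U)"
      by (rule lift_Un[OF tUV tV tU disj]) (auto simp: cyc_def)
    then have "three (?V \<union> ?U) = three ?V \<otimes>\<^bsub>DGr\<^esub> three ?U"
      using three_DG[OF tV] three_DG[OF tU] by (simp add: Bij_mult DG_Bij)
    then have "h (three (?V \<union> ?U)) = h (three ?V) \<otimes>\<^bsub>Q\<^esub> h (three ?U)"
      using h three_DG[OF tV] three_DG[OF tU] by (simp add: hom_def)
    then show ?case unfolding eq using piece[of x] x hU clopens_Un[OF Vc Uc] by simp
  qed
  from this[OF finite_cyls subset_refl] have "h (three (W \<inter> \<Union>(cyl K ` X))) = \<one>\<^bsub>Q\<^esub>" by simp
  moreover have "W \<inter> \<Union>(cyl K ` X) = W" using clopens_subset[OF Wc] cyl_self by blast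
  ultimately show ?thesis by simp
qed

end

section \<open>Finite presentations and words\<close>

abbreviation fg_class :: "'s set \<Rightarrow> ('s \<times> bool) list \<Rightarrow> ('s \<times> bool) list set" where
  "fg_class S w \<equiv> fg_eq S `` {w}"

lemma fg_class_carrier: "w \<in> fg_words S \<Longrightarrow> fg_class S w \<in> carrier (free_group S)"
  by (auto simp: free_group_def intro: quotientI)

lemma free_group_carrierE:
  assumes "U \<in> carrier (free_group S)"
  obtains w where "w \<in> fg_words S" "U = fg_class S w"
  using assms by (auto simp: free_group_def elim!: quotientE)

text \<open>The generating set of conjugates is itself closed under conjugation.\<close>

lemma normal_closure_normal:
  assumes "group G" "R \<subseteq> carrier G"
  shows "normal (normal_closure G R) G"
proof -
  interpret group G by (rule assms(1))
  show ?thesis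
    unfolding normal_closure_def
  proof (rule normal_generateI)
    show "{g \<otimes>\<^bsub>G\<^esub> r \<otimes>\<^bsub>G\<^esub> inv\<^bsub>G\<^esub> g | g r. g \<in> carrier G \<and> r \<in> R} \<subseteq> carrier G"
      using assms(2) by auto
    fix h g assume h: "h \<in> {g \<otimes>\<^bsub>G\<^esub> r \<otimes>\<^bsub>G\<^esub> inv\<^bsub>G\<^esub> g | g r. g \<in> carrier G \<and> r \<in> R}"
      and g: "g \<in> carrier G"
    then obtain k r where k: "k \<in> carrier G" "r \<in> R" "h = k \<otimes>\<^bsub>G\<^esub> r \<otimes>\<^bsub>G\<^esub> inv\<^bsub>G\<^esub> k" by blast
    then have r: "r \<in> carrier G" using assms(2) by blast
    have "g \<otimes>\<^bsub>G\<^esub> h \<otimes>\<^bsub>G\<^esub> inv\<^bsub>G\<^esub> g = (g \<otimes>\<^bsub>G\<^esub> k) \<otimes>\<^bsub>G\<^esub> r \<otimes>\<^bsub>G\<^esub> inv\<^bsub>G\<^esub> (g \<otimes>\<^bsub>G\<^esub> k)"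
      using k r g by (simp add: m_assoc inv_mult_group)
    then show "g \<otimes>\<^bsub>G\<^esub> h \<otimes>\<^bsub>G\<^esub> inv\<^bsub>G\<^esub> g \<in> {g \<otimes>\<^bsub>G\<^esub> r \<otimes>\<^bsub>G\<^esub> inv\<^bsub>G\<^esub> g | g r. g \<in> carrier G \<and> r \<in> R}"
      using k g by blast
  qed
qed

lemma normal_closure_incl:
  assumes "group G" "R \<subseteq> carrier G" "r \<in> R"
  shows "r \<in> normal_closure G R"
proof -
  interpret group G by (rule assms(1))
  have "r = \<one>\<^bsub>G\<^esub> \<otimes>\<^bsub>G\<^esub> r \<otimes>\<^bsub>G\<^esub> inv\<^bsub>G\<^esub> \<one>\<^bsub>G\<^esub>" using assms by auto
  then have "r \<in> {g \<otimes>\<^bsub>G\<^esub> r \<otimes>\<^bsub>G\<^esub> inv\<^bsub>G\<^esub> g | g r. g \<in> carrier G \<and> r \<in> R}"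
    using assms(3) one_closed by blast
  then show ?thesis unfolding normal_closure_def by (rule generate.incl)
qed

text \<open>Von Dyck's theorem.  The words \<open>s s\<^sup>-\<^sup>1\<close> are put among the relators \<open>Rw\<close>, so that \<open>\<theta>\<close> can be
  given on words instead of elements of the free group.\<close>

lemma finitely_presented_words:
  fixes G :: "('g, 'm) monoid_scheme"
  assumes fp: "finitely_presented G" and G: "group G"
  obtains S :: "nat set" and \<psi> Rw where "finite S" "finite Rw" "Rw \<subseteq> fg_words S"
    "\<forall>s\<in>S. \<forall>b. [(s, b), (s, \<not> b)] \<in> Rw"
    "\<forall>w\<in>fg_words S. \<psi> w \<in> carrier G"
    "\<forall>u\<in>fg_words S. \<forall>v\<in>fg_words S. \<psi> (u @ v) = \<psi> u \<otimes>\<^bsub>G\<^esub> \<psi> v"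
    "\<forall>g\<in>carrier G. \<exists>w\<in>fg_words S. \<psi> w = g"
    "\<forall>r\<in>Rw. \<psi> r = \<one>\<^bsub>G\<^esub>"
    "\<forall>(Q :: 'q monoid) \<theta>. group Q \<longrightarrow> (\<forall>w\<in>fg_words S. \<theta> w \<in> carrier Q) \<longrightarrow>
      (\<forall>u\<in>fg_words S. \<forall>v\<in>fg_words S. \<theta> (u @ v) = \<theta> u \<otimes>\<^bsub>Q\<^esub> \<theta> v) \<longrightarrow>
      (\<forall>r\<in>Rw. \<theta> r = \<one>\<^bsub>Q\<^esub>) \<longrightarrow>
      (\<exists>h\<in>hom G Q. \<forall>w\<in>fg_words S. h (\<psi> w) = \<theta> w)"
proof -
  interpret G: group G by (rule G)
  obtain S :: "nat set" and R where S: "finite S" "finite R" "R \<subseteq> carrier (free_group S)"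
    and "G \<cong> free_group S Mod normal_closure (free_group S) R"
    using fp unfolding finitely_presented_def by blast
  then obtain \<Phi> where \<Phi>: "\<Phi> \<in> iso G (free_group S Mod normal_closure (free_group S) R)"
    unfolding is_iso_def by blast
  define F where "F = free_group S"
  define N where "N = normal_closure F R"
  interpret F: group F unfolding F_def by (rule group_free_group)
  have RF: "R \<subseteq> carrier F" using S by (simp add: F_def)
  interpret N: normal N F unfolding N_def by (rule normal_closure_normal[OF F.group_axioms RF])
  have \<Phi>hom: "\<Phi> \<in> hom G (F Mod N)" and bij: "bij_betw \<Phi> (carrier G) (carrier (F Mod N))"
    using \<Phi> by (auto simp: iso_def F_def N_def)
  have FN: "group (F Mod N)" by (rule N.factorgroup_is_group)
  define cls where "cls w = fg_class S w" for w
  have cls: "cls w \<in> carrier F" if "w \<in> fg_words S" for w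
    using fg_class_carrier[OF that] by (simp add: cls_def F_def)
  have cls_append: "cls (u @ v) = cls u \<otimes>\<^bsub>F\<^esub> cls v" if "u \<in> fg_words S" "v \<in> fg_words S" for u v
    using free_group_mult[OF that] by (simp add: cls_def F_def)
  have cls_eq: "cls u = cls v" if "(u, v) \<in> fg_eq S" for u v
    unfolding cls_def by (rule equiv_class_eq[OF equiv_fg_eq that])
  have cls_nil: "cls [] = \<one>\<^bsub>F\<^esub>" by (simp add: cls_def F_def free_group_def)
  have clsE: "\<exists>w\<in>fg_words S. U = cls w" if "U \<in> carrier F" for U
    using that free_group_carrierE[of U S] unfolding F_def cls_def by blast
  \<comment> \<open>Evaluation of a word in \<open>G\<close>: the coset of its class, pulled back
    through the isomorphism.\<close>
  define \<psi> where "\<psi> w = inv_into (carrier G) \<Phi> (N #>\<^bsub>F\<^esub> cls w)" for w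
  have cos: "N #>\<^bsub>F\<^esub> cls w \<in> carrier (F Mod N)" if "w \<in> fg_words S" for w
    using cls[OF that] by (auto simp: FactGroup_def RCOSETS_def)
  have \<Phi>\<psi>: "\<Phi> (\<psi> w) = N #>\<^bsub>F\<^esub> cls w" if "w \<in> fg_words S" for w
    unfolding \<psi>_def using cos[OF that] bij by (intro f_inv_into_f) (simp add: bij_betw_def)
  have \<psi>G: "\<psi> w \<in> carrier G" if "w \<in> fg_words S" for w
    unfolding \<psi>_def using cos[OF that] bij by (intro inv_into_into) (simp add: bij_betw_def)
  have inj: "x = y" if "\<Phi> x = \<Phi> y" "x \<in> carrier G" "y \<in> carrier G" for x y
    using bij that by (auto simp: bij_betw_def dest: inj_onD)
  have \<psi>mult: "\<psi> (u @ v) = \<psi> u \<otimes>\<^bsub>G\<^esub> \<psi> v" if "u \<in> fg_words S" "v \<in> fg_words S" for u v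
  proof (rule inj)
    have uv: "u @ v \<in> fg_words S" using that by simp
    show "\<psi> (u @ v) \<in> carrier G" by (rule \<psi>G[OF uv])
    show "\<psi> u \<otimes>\<^bsub>G\<^esub> \<psi> v \<in> carrier G" using \<psi>G that by simp
    have "\<Phi> (\<psi> u \<otimes>\<^bsub>G\<^esub> \<psi> v) = \<Phi> (\<psi> u) <#>\<^bsub>F\<^esub> \<Phi> (\<psi> v)"
      using \<Phi>hom \<psi>G that by (simp add: hom_def FactGroup_def)
    also have "\<dots> = N #>\<^bsub>F\<^esub> (cls u \<otimes>\<^bsub>F\<^esub> cls v)"
      using \<Phi>\<psi> that cls by (simp add: N.rcos_sum)
    finally show "\<Phi> (\<psi> (u @ v)) = \<Phi> (\<psi> u \<otimes>\<^bsub>G\<^esub> \<psi> v)"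
      using \<Phi>\<psi>[OF uv] cls_append[OF that] by simp
  qed
  have \<psi>surj: "\<exists>w\<in>fg_words S. \<psi> w = g" if g: "g \<in> carrier G" for g
  proof -
    have "\<Phi> g \<in> carrier (F Mod N)" using bij g bij_betwE by blast
    then obtain U where U: "U \<in> carrier F" "\<Phi> g = N #>\<^bsub>F\<^esub> U"
      by (auto simp: FactGroup_def RCOSETS_def)
    then obtain w where w: "w \<in> fg_words S" "U = cls w" using clsE by blast
    have "\<psi> w = g" using \<Phi>\<psi>[OF w(1)] U w by (intro inj \<psi>G g) auto
    then show ?thesis using w by blast
  qed
  have \<psi>one: "\<psi> w = \<one>\<^bsub>G\<^esub>" if "w \<in> fg_words S" "cls w \<in> N" for w
  proof (rule inj)
    have "\<Phi> \<one>\<^bsub>G\<^esub> = \<one>\<^bsub>F Mod N\<^esub>" by (rule hom_one[OF \<Phi>hom G FN])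
    then show "\<Phi> (\<psi> w) = \<Phi> \<one>\<^bsub>G\<^esub>"
      using \<Phi>\<psi>[OF that(1)] N.rcos_const[OF F.group_axioms that(2)] by (simp add: FactGroup_def)
  qed (use \<psi>G that in auto)
  have "\<exists>w. \<forall>r\<in>R. w r \<in> fg_words S \<and> r = cls (w r)" using clsE RF by (metis subsetD)
  then obtain rep where rep: "\<And>r. r \<in> R \<Longrightarrow> rep r \<in> fg_words S" "\<And>r. r \<in> R \<Longrightarrow> r = cls (rep r)" by blast
  define Rw where "Rw = rep ` R \<union> (\<lambda>(s, b). [(s, b), (s, \<not> b)]) ` (S \<times> UNIV)"
  have cancel: "[(s, b), (s, \<not> b)] \<in> Rw" if "s \<in> S" for s b
    unfolding Rw_def using that by (intro UnI2 image_eqI[of _ _ "(s, b)"]) auto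
  have Rw: "Rw \<subseteq> fg_words S" using rep(1) by (auto simp: Rw_def)
  have finRw: "finite Rw" using S by (simp add: Rw_def)
  have clsRw: "cls r \<in> N" if "r \<in> Rw" for r
  proof -
    have "(\<exists>q\<in>R. r = rep q) \<or> (\<exists>s\<in>S. \<exists>b. r = [(s, b), (s, \<not> b)])"
      using that by (auto simp: Rw_def)
    then consider q where "q \<in> R" "r = rep q" | s b where "s \<in> S" "r = [(s, b), (s, \<not> b)]"
      by blast
    then show ?thesis
    proof cases
      case 1
      then show ?thesis using rep(2)[OF 1(1)] normal_closure_incl[OF F.group_axioms RF 1(1)]
        by (simp add: N_def)
    next
      case 2
      have "(r, []) \<in> fg_eq S" using fg_eq.cancel[of "[]" S "[]" s b] 2 by simp
      then show ?thesis using cls_eq cls_nil N.one_closed by metis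
    qed
  qed
  have "\<exists>h\<in>hom G Q. \<forall>w\<in>fg_words S. h (\<psi> w) = \<theta> w"
    if Q: "group Q" and \<theta>: "\<forall>w\<in>fg_words S. \<theta> w \<in> carrier Q"
      "\<forall>u\<in>fg_words S. \<forall>v\<in>fg_words S. \<theta> (u @ v) = \<theta> u \<otimes>\<^bsub>Q\<^esub> \<theta> v" "\<forall>r\<in>Rw. \<theta> r = \<one>\<^bsub>Q\<^esub>"
    for Q :: "'q monoid" and \<theta>
  proof -
    interpret Q: group Q by (rule Q)
    have \<theta>Q: "\<theta> w \<in> carrier Q" if "w \<in> fg_words S" for w using \<theta>(1) that by blast
    have \<theta>m: "\<theta> (u @ v) = \<theta> u \<otimes>\<^bsub>Q\<^esub> \<theta> v" if "u \<in> fg_words S" "v \<in> fg_words S" for u v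
      using \<theta>(2) that by blast
    \<comment> \<open>Multiplicativity and triviality on cancelling pairs make
      \<open>\<theta>\<close> constant on the classes of the free group.\<close>
    have \<theta>eq: "\<theta> u = \<theta> v" if "(u, v) \<in> fg_eq S" for u v
      using that
    proof (induction rule: fg_eq.induct)
      case (cancel u v s b)
      have c: "[(s, b), (s, \<not> b)] \<in> fg_words S" using cancel by simp
      have "\<theta> (u @ [(s, b), (s, \<not> b)] @ v) = \<theta> u \<otimes>\<^bsub>Q\<^esub> (\<theta> [(s, b), (s, \<not> b)] \<otimes>\<^bsub>Q\<^esub> \<theta> v)"
        using \<theta>m[OF cancel(1), of "[(s, b), (s, \<not> b)] @ v"] \<theta>m[OF c cancel(2)] cancel by simp
      also have "\<theta> [(s, b), (s, \<not> b)] = \<one>\<^bsub>Q\<^esub>"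
        using \<theta>(3) \<open>\<And>s b. s \<in> S \<Longrightarrow> [(s, b), (s, \<not> b)] \<in> Rw\<close> cancel(3) by blast
      finally show ?case using \<theta>m[OF cancel(1,2)] \<theta>Q[OF cancel(2)] by simp
    qed auto
    define \<Theta> where "\<Theta> U = \<theta> (SOME w. w \<in> U)" for U
    have \<Theta>: "\<Theta> (cls w) = \<theta> w" if "w \<in> fg_words S" for w
    proof -
      have "w \<in> cls w" using that by (simp add: cls_def fg_eq.refl)
      then have "(SOME v. v \<in> cls w) \<in> cls w" by (rule someI)
      then have "(w, SOME v. v \<in> cls w) \<in> fg_eq S" by (simp add: cls_def)
      then show ?thesis unfolding \<Theta>_def using \<theta>eq by metis
    qed
    have "\<Theta> \<in> hom F Q"
    proof (rule homI)
      fix U assume "U \<in> carrier F"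
      then obtain u where "u \<in> fg_words S" "U = cls u" using clsE by blast
      then show "\<Theta> U \<in> carrier Q" using \<Theta> \<theta>Q by simp
    next
      fix U V assume "U \<in> carrier F" "V \<in> carrier F"
      then obtain u v where "u \<in> fg_words S" "U = cls u" "v \<in> fg_words S" "V = cls v"
        using clsE by blast
      then show "\<Theta> (U \<otimes>\<^bsub>F\<^esub> V) = \<Theta> U \<otimes>\<^bsub>Q\<^esub> \<Theta> V"
        using \<Theta>[of "u @ v"] \<Theta>[of u] \<Theta>[of v] \<theta>m cls_append by simp
    qed
    then interpret \<Theta>: group_hom F Q \<Theta>
      by (simp add: group_hom_def group_hom_axioms_def F.group_axioms Q)
    have "N \<subseteq> kernel F Q \<Theta>"
      unfolding N_def normal_closure_def
    proof (rule F.generate_subgroup_incl[OF _ \<Theta>.subgroup_kernel], rule subsetI)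
      fix x assume "x \<in> {g \<otimes>\<^bsub>F\<^esub> r \<otimes>\<^bsub>F\<^esub> inv\<^bsub>F\<^esub> g | g r. g \<in> carrier F \<and> r \<in> R}"
      then obtain g r where x: "x = g \<otimes>\<^bsub>F\<^esub> r \<otimes>\<^bsub>F\<^esub> inv\<^bsub>F\<^esub> g" "g \<in> carrier F" "r \<in> R" by blast
      have r: "r \<in> carrier F" using x RF by blast
      have "\<Theta> r = \<one>\<^bsub>Q\<^esub>" using rep[OF x(3)] \<Theta>[of "rep r"] \<theta>(3) x(3) by (auto simp: Rw_def)
      then show "x \<in> kernel F Q \<Theta>" using x r by (simp add: kernel_def)
    qed
    then have \<Theta>N: "\<Theta> n = \<one>\<^bsub>Q\<^esub>" if "n \<in> N" for n using that by (auto simp: kernel_def)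
    \<comment> \<open>Equal values of \<open>\<psi>\<close> mean equal cosets of \<open>N\<close>,
      and the map induced on the free group kills \<open>N\<close>; hence \<open>\<theta>\<close>
      factors through \<open>G\<close>.\<close>
    have wd: "\<theta> u = \<theta> v" if uv: "u \<in> fg_words S" "v \<in> fg_words S" "\<psi> u = \<psi> v" for u v
    proof -
      have "N #>\<^bsub>F\<^esub> cls u = N #>\<^bsub>F\<^esub> cls v" using \<Phi>\<psi> uv by metis
      then have "cls u \<in> N #>\<^bsub>F\<^esub> cls v"
        using F.rcos_self[OF cls[OF uv(1)] N.subgroup_axioms] by simp
      then obtain n where n: "n \<in> N" "cls u = n \<otimes>\<^bsub>F\<^esub> cls v" by (auto simp: r_coset_def)
      then have "\<Theta> (cls u) = \<Theta> (cls v)"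
        using \<Theta>N[OF n(1)] cls[OF uv(2)] N.mem_carrier[OF n(1)] by simp
      then show ?thesis using \<Theta> uv by simp
    qed
    define h where "h g = \<theta> (SOME w. w \<in> fg_words S \<and> \<psi> w = g)" for g
    have h\<psi>: "h (\<psi> w) = \<theta> w" if "w \<in> fg_words S" for w
    proof -
      have "(SOME v. v \<in> fg_words S \<and> \<psi> v = \<psi> w) \<in> fg_words S \<and> \<psi> (SOME v. v \<in> fg_words S \<and> \<psi> v = \<psi> w) = \<psi> w"
        by (rule someI[of _ w]) (use that in simp)
      then show ?thesis unfolding h_def using wd that by blast
    qed
    have "h \<in> hom G Q"
    proof (rule homI)
      fix x assume "x \<in> carrier G"
      then obtain u where "u \<in> fg_words S" "x = \<psi> u" using \<psi>surj by blast
      then show "h x \<in> carrier Q" using h\<psi> \<theta>Q by simp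
    next
      fix x y assume "x \<in> carrier G" "y \<in> carrier G"
      then obtain u v where "u \<in> fg_words S" "x = \<psi> u" "v \<in> fg_words S" "y = \<psi> v" using \<psi>surj by metis
      then show "h (x \<otimes>\<^bsub>G\<^esub> y) = h x \<otimes>\<^bsub>Q\<^esub> h y"
        using h\<psi>[of "u @ v"] h\<psi>[of u] h\<psi>[of v] \<theta>m \<psi>mult by simp
    qed
    then show ?thesis using h\<psi> by blast
  qed
  moreover have "\<psi> r = \<one>\<^bsub>G\<^esub>" if "r \<in> Rw" for r
    by (rule \<psi>one[OF subsetD[OF Rw that] clsRw[OF that]])
  ultimately show thesis
    using S(1) finRw Rw cancel \<psi>G \<psi>mult \<psi>surj by (intro that[of S Rw \<psi>]) auto
qed

section \<open>Periodic approximation\<close>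

text \<open>\<open>word_cocycle n w x\<close> is the total displacement of \<open>x\<close> under the word \<open>w\<close>, read as
  a composition of maps, when the letter \<open>a\<close> displaces \<open>x\<close> by \<open>n a x\<close>.\<close>

fun word_cocycle :: "('l \<Rightarrow> (int \<Rightarrow> 'a) \<Rightarrow> int) \<Rightarrow> 'l list \<Rightarrow> (int \<Rightarrow> 'a) \<Rightarrow> int" where
  "word_cocycle n [] x = 0"
| "word_cocycle n (a # w) x = word_cocycle n w x + n a (sh (word_cocycle n w x) x)"

lemma word_cocycle_append:
  "word_cocycle n (u @ v) x = word_cocycle n v x + word_cocycle n u (sh (word_cocycle n v x) x)"
  by (induction u) (simp_all add: add.commute add.left_commute)

context aperiodic_subshift
begin

text \<open>Sampling an orbit at multiples of \<open>L + 1\<close> gives two equal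
  \<open>L\<close>-windows at a distance \<open>p > L\<close>, and the stretch between them is
  repeated. A window of the repetition overhangs the stretch by at most \<open>L\<close> on either
  side, where equality of the two windows applies.\<close>

lemma periodic_approximation:
  "\<exists>p y. p > 0 \<and> sh p y = y \<and> (\<forall>i. \<exists>x\<in>X. agree L (sh i y) x)"
proof -
  obtain x where x: "x \<in> X" using nonempty by blast
  let ?r = "\<lambda>x. restrict x {- int L..int L}"
  let ?f = "\<lambda>i::nat. ?r (sh (int i * (int L + 1)) x)"
  have "finite (range ?f)"
    by (rule finite_subset[OF _ finite_windows[of L]]) (use x in auto)
  then have "\<not> inj ?f" using finite_imageD infinite_UNIV_nat by blast
  then obtain i j where ij: "i < j" "?f i = ?f j"
    unfolding inj_on_def by (metis linorder_neqE_nat)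
  define z where "z = sh (int i * (int L + 1)) x"
  define p where "p = int (j - i) * (int L + 1)"
  have z: "z \<in> X" using x by (simp add: z_def)
  have p: "p \<ge> int L + 1"
    using ij(1) mult_right_mono[of 1 "int (j - i)" "int L + 1"] by (simp add: p_def)
  have "p + int i * (int L + 1) = int j * (int L + 1)"
    using ij(1) by (simp add: p_def of_nat_diff algebra_simps)
  then have "agree L z (sh p z)"
    using ij(2) unfolding restrict_eq_agree by (simp add: z_def)
  then have zp: "z t = z (t + p)" if "\<bar>t\<bar> \<le> int L" for t
    using that by (simp add: agree_def seq_shift_pow_def)
  define y where "y = (\<lambda>t. z (t mod p))"
  have "sh p y = y" by (simp add: y_def seq_shift_pow_def)
  moreover have "agree L (sh i y) (sh (i mod p) z)" for i
    unfolding agree_def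
  proof (intro allI impI)
    fix t :: int assume t: "\<bar>t\<bar> \<le> int L"
    define s where "s = t + i mod p"
    have q: "0 \<le> i mod p" "i mod p < p" using p by auto
    have "sh i y t = z (s mod p)"
      by (simp add: y_def seq_shift_pow_def s_def mod_add_right_eq)
    also have "\<dots> = z s"
    proof -
      \<comment> \<open>Positions range from \<open>- L\<close> to \<open>p + L - 1\<close>. As
        \<open>p > L\<close>, one period brings the outer ones back, and \<open>zp\<close> applies
        at the smaller of the two positions.\<close>
      consider "s < 0" | "0 \<le> s" "s < p" | "p \<le> s" by linarith
      then show ?thesis
      proof cases
        case 1
        then have b: "0 \<le> s + p" "s + p < p" "\<bar>s\<bar> \<le> int L" using q t p unfolding s_def by linarith+
        have "s mod p = s + p" using mod_pos_pos_trivial[OF b(1,2)] by simp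
        then show ?thesis using zp[OF b(3)] by simp
      next
        case 2
        then show ?thesis by simp
      next
        case 3
        then have b: "0 \<le> s - p" "s - p < p" "\<bar>s - p\<bar> \<le> int L" using q t p unfolding s_def by linarith+
        have "s mod p = s - p" using mod_pos_pos_trivial[OF b(1,2)] by (simp add: mod_diff_right_eq)
        then show ?thesis using zp[OF b(3)] by simp
      qed
    qed
    finally show "sh i y t = sh (i mod p) z t" by (simp add: seq_shift_pow_def s_def)
  qed
  then have "\<forall>i. \<exists>x\<in>X. agree L (sh i y) x" using z by (meson sh_X_iff)
  ultimately show ?thesis using p by (intro exI[of _ p] exI[of _ y]) auto
qed

lemma not_finitely_presented_DGr: "\<not> finitely_presented DGr"
proof
  assume fp: "finitely_presented DGr"
  obtain S :: "nat set" and \<psi> Rw where S: "finite S" "finite Rw" "Rw \<subseteq> fg_words S"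
    and cancel: "\<forall>s\<in>S. \<forall>b. [(s, b), (s, \<not> b)] \<in> Rw"
    and \<psi>G: "\<forall>w\<in>fg_words S. \<psi> w \<in> carrier DGr"
    and \<psi>mult: "\<forall>u\<in>fg_words S. \<forall>v\<in>fg_words S. \<psi> (u @ v) = \<psi> u \<otimes>\<^bsub>DGr\<^esub> \<psi> v"
    and \<psi>onto: "\<forall>g\<in>carrier DGr. \<exists>w\<in>fg_words S. \<psi> w = g"
    and \<psi>Rw: "\<forall>r\<in>Rw. \<psi> r = \<one>\<^bsub>DGr\<^esub>"
    and univ: "\<forall>(Q :: ((int \<Rightarrow> 'a) \<Rightarrow> (int \<Rightarrow> 'a)) monoid) \<theta>. group Q \<longrightarrow>
      (\<forall>w\<in>fg_words S. \<theta> w \<in> carrier Q) \<longrightarrow>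
      (\<forall>u\<in>fg_words S. \<forall>v\<in>fg_words S. \<theta> (u @ v) = \<theta> u \<otimes>\<^bsub>Q\<^esub> \<theta> v) \<longrightarrow>
      (\<forall>r\<in>Rw. \<theta> r = \<one>\<^bsub>Q\<^esub>) \<longrightarrow>
      (\<exists>h\<in>hom DGr Q. \<forall>w\<in>fg_words S. h (\<psi> w) = \<theta> w)"
    \<comment> \<open>The universal property speaks of target groups of one type; the target here
      will be permutations of a set of sequences.\<close>
    by (rule finitely_presented_words[OF fp group_DGr, where 'q = "(int \<Rightarrow> 'a) \<Rightarrow> (int \<Rightarrow> 'a)"])
      (rule that)
  have \<psi>D: "\<psi> w \<in> DG" if "w \<in> fg_words S" for w using \<psi>G that by simp
  have \<psi>m: "\<psi> (u @ v) = \<psi> u \<otimes>\<^bsub>DGr\<^esub> \<psi> v" if "u \<in> fg_words S" "v \<in> fg_words S" for u v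
    using \<psi>mult that by blast
  have \<psi>surj: "\<exists>w\<in>fg_words S. \<psi> w = g" if "g \<in> DG" for g using \<psi>onto that by simp
  have \<psi>comp: "\<psi> (u @ v) = compose X (\<psi> u) (\<psi> v)" if "u \<in> fg_words S" "v \<in> fg_words S" for u v
    using \<psi>m[OF that] \<psi>D that by (simp add: Bij_mult DG_Bij)
  have \<psi>nil: "\<psi> [] = (\<lambda>x\<in>X. x)"
  proof -
    interpret D: group DGr by (rule group_DGr)
    have "\<psi> [] \<otimes>\<^bsub>DGr\<^esub> \<psi> [] = \<psi> []" using \<psi>m[of "[]" "[]"] by simp
    then have "\<psi> [] = \<one>\<^bsub>DGr\<^esub>" using D.l_cancel_one[of "\<psi> []" "\<psi> []"] \<psi>D[of "[]"] by simp
    then show ?thesis by (simp add: BijGroup_def)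
  qed
  have \<psi>R1: "\<psi> r x = x" if "r \<in> Rw" "x \<in> X" for r x
    using \<psi>Rw that by (simp add: BijGroup_def)

  define letters where "letters = S \<times> (UNIV :: bool set)"
  have fin: "finite letters" using S by (simp add: letters_def)
  have word1: "[a] \<in> fg_words S" if "a \<in> letters" for a using that by (simp add: letters_def)
  define c where "c a = coc (\<psi> [a])" for a
  have FG1: "\<psi> [a] \<in> FG" if "a \<in> letters" for a using \<psi>D[OF word1[OF that]] DG_FG by blast
  have "\<forall>a\<in>letters. \<exists>k. local_on X k (c a)" using FG1 FG_local unfolding c_def by blast
  then obtain kk where kk: "\<And>a. a \<in> letters \<Longrightarrow> local_on X (kk a) (c a)" by metis
  then have "\<forall>a\<in>letters. \<exists>b. \<forall>x\<in>X. \<bar>c a x\<bar> \<le> int b" using local_imp_bounded by blast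
  then obtain bb where bb: "\<And>a x. a \<in> letters \<Longrightarrow> x \<in> X \<Longrightarrow> \<bar>c a x\<bar> \<le> int (bb a)" by metis
  define k where "k = (\<Sum>a\<in>letters. kk a)"
  define b where "b = (\<Sum>a\<in>letters. bb a)"
  have kloc: "local_on X k (c a)" if "a \<in> letters" for a
    by (rule local_on_mono[OF kk[OF that]]) (simp add: k_def member_le_sum fin that)
  have bbd: "\<bar>c a x\<bar> \<le> int b" if "a \<in> letters" "x \<in> X" for a x
  proof -
    have "bb a \<le> b" by (simp add: b_def member_le_sum fin that)
    then show ?thesis using bb[OF that] by linarith
  qed
  \<comment> \<open>The local rule of a generator, read off any point of \<open>X\<close> with the
    same \<open>k\<close>-window, so that it also applies to sequences outside \<open>X\<close>. The
    default 0 is for windows that do not occur in \<open>X\<close>.\<close>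
  define n where "n a x = (if \<exists>x'\<in>X. agree k x x' then c a (SOME x'. x' \<in> X \<and> agree k x x') else 0)" for a x
  have n: "n a x = c a x'" if "a \<in> letters" "x' \<in> X" "agree k x x'" for a x x'
  proof -
    let ?s = "SOME x'. x' \<in> X \<and> agree k x x'"
    have s: "?s \<in> X \<and> agree k x ?s" by (rule someI[of _ x']) (use that in simp)
    then have "agree k ?s x'" using agree_trans[OF agree_sym that(3)] by blast
    then have "c a ?s = c a x'" using local_onD[OF kloc[OF that(1)]] s that(2) by blast
    then show ?thesis using that(2,3) by (auto simp: n_def)
  qed
  let ?N = "word_cocycle n"
  have onX: "\<psi> w x = sh (?N w x) x" if "w \<in> fg_words S" "x \<in> X" for w x
    using that(1)
  proof (induction w)
    case Nil
    then show ?case using \<psi>nil that(2) by simp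
  next
    case (Cons a w)
    then have a: "a \<in> letters" and w: "w \<in> fg_words S" by (auto simp: letters_def)
    have IH: "\<psi> w x = sh (?N w x) x" by (rule Cons.IH)
    have m: "sh (?N w x) x \<in> X" using that(2) by simp
    have "\<psi> (a # w) x = \<psi> [a] (\<psi> w x)"
      using \<psi>comp[OF word1[OF a] w] that(2) by (simp add: compose_def)
    also have "\<dots> = sh (c a (sh (?N w x) x)) (sh (?N w x) x)"
      unfolding IH c_def by (rule FG_coc[OF FG1[OF a] m])
    also have "c a (sh (?N w x) x) = n a (sh (?N w x) x)" using n[OF a m] by simp
    finally show ?case by (simp add: add.commute)
  qed
  \<comment> \<open>Each letter moves a point by at most \<open>b\<close> and inspects a
    \<open>k\<close>-window, so \<open>k + b * length w\<close> coordinates on either side determine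
    the whole displacement.\<close>
  have Nloc: "\<bar>?N w x\<bar> \<le> int (b * length w) \<and> ?N w y = ?N w x"
    if "w \<in> fg_words S" "x \<in> X" "agree (k + b * length w) y x" for w x y
    using that(1,3)
  proof (induction w)
    case (Cons a w)
    then have a: "a \<in> letters" and w: "w \<in> fg_words S" by (auto simp: letters_def)
    have "agree (k + b * length w) y x" by (rule agree_mono[OF Cons.prems]) simp
    then have IH: "\<bar>?N w x\<bar> \<le> int (b * length w)" "?N w y = ?N w x" using Cons.IH by auto
    let ?m = "?N w x"
    have m: "sh ?m x \<in> X" using that(2) by simp
    have "agree k (sh ?m y) (sh ?m x)"
      by (rule agree_sh[OF Cons.prems]) (use IH(1) in \<open>simp add: nat_le_iff\<close>)
    then have "n a (sh ?m y) = c a (sh ?m x)" using n[OF a m] by simp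
    moreover have "n a (sh ?m x) = c a (sh ?m x)" using n[OF a m] by simp
    moreover have "\<bar>c a (sh ?m x)\<bar> \<le> int b" by (rule bbd[OF a m])
    ultimately show ?case using IH by (simp add: algebra_simps)
  qed simp

  \<comment> \<open>Excluding return times up to 2 makes the three levels over every
    \<open>k0\<close>-cylinder disjoint.\<close>
  obtain k0 where k0: "\<forall>x\<in>X. \<forall>d. d \<noteq> 0 \<and> \<bar>d\<bar> \<le> int 2 \<longrightarrow> \<not> agree k0 x (sh d x)"
    using separation by blast
  have tw: "tower {0, 1, 2} (cyl k0 x)" for x by (rule tower_cyl[OF k0]) auto
  have "\<forall>C\<in>cyl k0 ` X. \<exists>w\<in>fg_words S. \<psi> w = three C" using tw three_DG \<psi>surj by blast
  then obtain wd where wd: "\<And>C. C \<in> cyl k0 ` X \<Longrightarrow> wd C \<in> fg_words S"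
    "\<And>C. C \<in> cyl k0 ` X \<Longrightarrow> \<psi> (wd C) = three C" by metis
  define Wd where "Wd = Rw \<union> wd ` (cyl k0 ` X)"
  have Wd: "finite Wd" "Wd \<subseteq> fg_words S" using S wd(1) finite_cyls by (auto simp: Wd_def)
  \<comment> \<open>The sum is a crude common bound for the windows of all words in
    \<open>Wd\<close>; \<open>k0 + 1\<close> leaves room to compare \<open>k0\<close>-windows after
    a shift by 1.\<close>
  define L where "L = (\<Sum>w\<in>Wd. k + b * length w) + (k0 + 1)"
  have L: "k + b * length w \<le> L" if "w \<in> Wd" for w
    using member_le_sum[of w Wd "\<lambda>w. k + b * length w"] Wd that by (simp add: L_def)
  obtain p y where p: "p > 0" and py: "sh p y = y" and yX: "\<And>i. \<exists>x\<in>X. agree L (sh i y) x"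
    using periodic_approximation[of L] by blast

  define O' where "O' = range (\<lambda>i. sh i y)"
  have O_sh: "sh i x \<in> O'" if "x \<in> O'" for i x using that by (auto simp: O'_def)
  have O_X: "\<exists>x'\<in>X. agree L x x'" if "x \<in> O'" for x using that yX by (auto simp: O'_def)
  have "O' \<subseteq> (\<lambda>i. sh i y) ` {0..<p}"
  proof
    fix x assume "x \<in> O'"
    then obtain i where i: "x = sh i y" by (auto simp: O'_def)
    have per: "sh (int m * p) y = y \<and> sh (- (int m * p)) y = y" for m
    proof (induction m)
      case (Suc m)
      have "sh (int (Suc m) * p) y = sh (int m * p) (sh p y)" by (simp add: algebra_simps)
      moreover have "sh (- p) y = y"
      proof -
        have "sh (- p) (sh p y) = y" by simp
        then show ?thesis using py by simp
      qed
      then have "sh (- (int m * p)) (sh (- p) y) = sh (- (int m * p)) y" by simp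
      then have "sh (- (int (Suc m) * p)) y = sh (- (int m * p)) y" by (simp add: algebra_simps)
      ultimately show ?case using Suc py by simp
    qed simp
    have "sh (q * p) y = y" for q
      by (cases q rule: int_cases2) (use per in auto)
    then have "sh (i mod p) y = sh (i mod p) (sh (i div p * p) y)" by simp
    also have "\<dots> = x" using i by (simp add: add.commute)
    finally show "x \<in> (\<lambda>i. sh i y) ` {0..<p}" using p by (intro image_eqI[of _ _ "i mod p"]) auto
  qed
  then have finO: "finite O'" by (rule finite_subset) simp

  define \<theta> where "\<theta> w = (\<lambda>x\<in>O'. sh (?N w x) x)" for w
  have \<theta>mem: "\<theta> w x \<in> O'" if "x \<in> O'" for w x using that O_sh by (simp add: \<theta>_def)
  have \<theta>comp: "\<theta> (u @ v) = compose O' (\<theta> u) (\<theta> v)" for u v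
    using O_sh by (auto simp: \<theta>_def compose_def fun_eq_iff word_cocycle_append add.commute)
  \<comment> \<open>A relator fixes the nearby point \<open>x'\<close> of \<open>X\<close>, so its
    displacement there is 0 by aperiodicity, and \<open>x\<close> has the same displacement.\<close>
  have \<theta>R: "\<theta> r = (\<lambda>x\<in>O'. x)" if r: "r \<in> Rw" for r
  proof -
    have "?N r x = 0" if x: "x \<in> O'" for x
    proof -
      obtain x' where x': "x' \<in> X" "agree L x x'" using O_X[OF x] by blast
      have rW: "r \<in> Wd" "r \<in> fg_words S" using r S by (auto simp: Wd_def)
      have "?N r x = ?N r x'"
        using Nloc[OF rW(2) x'(1) agree_mono[OF x'(2) L[OF rW(1)]]] by simp
      moreover have "sh (?N r x') x' = x'" using onX[OF rW(2) x'(1)] \<psi>R1[OF r x'(1)] by simp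
      then have "?N r x' = 0" by (rule aperiodic[OF x'(1)])
      ultimately show ?thesis by simp
    qed
    then show ?thesis by (auto simp: \<theta>_def)
  qed
  \<comment> \<open>Nothing makes the local rules bijective on the orbit a priori; the cancelling
    pairs among the relators supply the inverses.\<close>
  have \<theta>1: "\<theta> [a] \<in> Bij O'" if "a \<in> letters" for a
  proof -
    obtain s t where a: "a = (s, t)" "s \<in> S" using \<open>a \<in> letters\<close> by (auto simp: letters_def)
    have "\<theta> [(s, q)] (\<theta> [(s, \<not> q)] x) = x" if "x \<in> O'" for q x
    proof -
      have "\<theta> ([(s, q)] @ [(s, \<not> q)]) x = x"
        using \<theta>R[of "[(s, q), (s, \<not> q)]"] cancel a(2) that by simp
      then show ?thesis unfolding \<theta>comp using that by (simp add: compose_def)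
    qed
    from this[of _ t] this[of _ "\<not> t"] have "bij_betw (\<theta> [(s, t)]) O' O'"
      by (intro bij_betw_byWitness[where f' = "\<theta> [(s, \<not> t)]"]) (use \<theta>mem in auto)
    then show ?thesis by (simp add: Bij_def a \<theta>_def)
  qed
  have \<theta>Bij: "\<theta> w \<in> Bij O'" if "w \<in> fg_words S" for w
    using that
  proof (induction w)
    case Nil
    have "\<theta> [] = (\<lambda>x\<in>O'. x)" by (simp add: \<theta>_def)
    then show ?case by (simp only: id_Bij)
  next
    case (Cons a w)
    then have "a \<in> letters" "w \<in> fg_words S" by (auto simp: letters_def)
    then show ?case using \<theta>comp[of "[a]" w] compose_Bij[OF \<theta>1 Cons.IH] by simp
  qed
  have "\<exists>h\<in>hom DGr (BijGroup O'). \<forall>w\<in>fg_words S. h (\<psi> w) = \<theta> w"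
  proof (rule univ[rule_format, OF group_BijGroup])
    show "\<theta> w \<in> carrier (BijGroup O')" if "w \<in> fg_words S" for w
      using \<theta>Bij[OF that] by (simp add: BijGroup_def)
    show "\<theta> (u @ v) = \<theta> u \<otimes>\<^bsub>BijGroup O'\<^esub> \<theta> v" if "u \<in> fg_words S" "v \<in> fg_words S" for u v
      using \<theta>comp \<theta>Bij that by (simp add: BijGroup_def)
    show "\<theta> r = \<one>\<^bsub>BijGroup O'\<^esub>" if "r \<in> Rw" for r using \<theta>R[OF that] by (simp add: BijGroup_def)
  qed
  then obtain h where h: "h \<in> hom DGr (BijGroup O')" "\<And>w. w \<in> fg_words S \<Longrightarrow> h (\<psi> w) = \<theta> w" by blast
  have finB: "finite (carrier (BijGroup O'))"
  proof (rule finite_subset)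
    show "carrier (BijGroup O') \<subseteq> Pi\<^sub>E O' (\<lambda>_. O')"
      by (auto simp: BijGroup_def Bij_def PiE_def bij_betw_def)
  qed (simp add: finite_PiE finO)

  have yO: "y \<in> O'" unfolding O'_def by (rule image_eqI[of _ _ 0]) auto
  then obtain x where x: "x \<in> X" "agree L y x" using O_X by blast
  define C where "C = cyl k0 x"
  have C: "C \<in> cyl k0 ` X" using x by (simp add: C_def)
  have w: "wd C \<in> fg_words S" "wd C \<in> Wd" using wd(1)[OF C] C by (auto simp: Wd_def)
  have "\<theta> (wd C) = h (three C)" using h(2)[OF w(1)] wd(2)[OF C] by simp
  also have "\<dots> = \<one>\<^bsub>BijGroup O'\<^esub>"
    unfolding C_def by (rule finite_quotient_kills[OF group_BijGroup finB h(1) tw])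
  finally have "\<theta> (wd C) y = y" using yO by (simp add: BijGroup_def)
  \<comment> \<open>The displacement at \<open>y\<close> equals that at \<open>x\<close>, which is
    1. So \<open>y\<close> is fixed by the shift, and \<open>x\<close>, which looks like
    \<open>y\<close>, agrees with its own shift on the \<open>k0\<close>-window, against the choice
    of \<open>k0\<close>.\<close>
  then have fixed: "sh (?N (wd C) y) y = y" using yO by (simp add: \<theta>_def)
  have "three C x = sh (cyc 0 1 2 0 - 0) x"
    unfolding C_def by (rule lift_on[OF tw]) (use x cyl_self in auto)
  then have "sh (?N (wd C) x) x = sh 1 x" using onX[OF w(1) x(1)] wd(2)[OF C] by (simp add: cyc_def)
  then have "?N (wd C) x = 1" using sh_inj[OF x(1)] by simp
  moreover have "?N (wd C) y = ?N (wd C) x"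
    using Nloc[OF w(1) x(1) agree_mono[OF x(2) L[OF w(2)]]] by simp
  ultimately have "sh 1 y = y" using fixed by simp
  then have "agree k0 y (sh 1 x)" using agree_sh[OF x(2), of k0 1] by (simp add: L_def)
  moreover have "agree k0 x y" using agree_mono[OF agree_sym[OF x(2)], of k0] by (simp add: L_def)
  ultimately have "agree k0 x (sh 1 x)" using agree_trans[of k0 x y] by blast
  then show False using k0 x(1) by auto
qed

end

text \<open>The orbit of a periodic point would be finite, hence closed and invariant, so minimality
  would make \<open>X\<close> finite, which a Cantor set is not. This puts \<open>X\<close> into
  \<open>aperiodic_subshift\<close>.\<close>

theorem theorem5p7:
  fixes A :: "'a set" and X :: "(int \<Rightarrow> 'a) set"
  assumes "finite A"
    and "minimal_subshift A X"
    and "cantor_set (subshift_topology A X)"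
  shows "\<not> finitely_presented (commutator_subgroup (full_group_0 A X))"
proof -
  interpret finite_subshift A X
    using assms by unfold_locales (auto simp: minimal_subshift_def)
  have inf: "infinite X"
  proof
    assume fin: "finite X"
    obtain f where f: "homeomorphic_map T (product_topology (\<lambda>_::nat. discrete_topology (UNIV :: bool set)) UNIV) f"
      using assms(3) unfolding cantor_set_def homeomorphic_space by blast
    have "f ` X = (UNIV :: (nat \<Rightarrow> bool) set)"
      using homeomorphic_imp_surjective_map[OF f] by simp
    then have "finite (UNIV :: (nat \<Rightarrow> bool) set)" using fin by (metis finite_imageI)
    moreover have "inj (\<lambda>n i :: nat. i = n)" by (auto simp: inj_def fun_eq_iff)
    ultimately show False using finite_imageD[of "\<lambda>n i :: nat. i = n" UNIV] finite_subset[OF subset_UNIV]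
      by blast
  qed
  interpret aperiodic_subshift A X
  proof unfold_locales
    show "X \<noteq> {}" using inf by auto
    fix x n assume x: "x \<in> X" and per: "sh n x = x"
    show "n = 0"
    proof (rule ccontr)
      assume n: "n \<noteq> 0"
      have perm: "sh (q * n) x = x" for q
      proof (induction q rule: int_induct[where k = 0])
        case (step1 i)
        have "sh ((i + 1) * n) x = sh (i * n) (sh n x)" by (simp add: algebra_simps)
        then show ?case using step1 per by simp
      next
        case (step2 i)
        have "sh n (sh ((i - 1) * n) x) = sh (i * n) x" by (simp add: algebra_simps)
        also have "\<dots> = x" by (rule step2.IH)
        also have "\<dots> = sh n x" using per ..
        finally have "sh (- n) (sh n (sh ((i - 1) * n) x)) = sh (- n) (sh n x)" by (rule arg_cong)
        then show ?case by simp
      qed simp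
      define Y where "Y = range (\<lambda>i. sh i x)"
      \<comment> \<open>The interval is symmetric because \<open>i mod n\<close> takes the sign of
        \<open>n\<close>, which may be negative.\<close>
      have "Y \<subseteq> (\<lambda>i. sh i x) ` {- \<bar>n\<bar>..\<bar>n\<bar>}"
      proof
        fix z assume "z \<in> Y"
        then obtain i where i: "z = sh i x" by (auto simp: Y_def)
        have "sh (i mod n) x = sh (i mod n) (sh (i div n * n) x)" using perm by simp
        also have "\<dots> = z" using i by (simp add: add.commute)
        finally have "z = sh (i mod n) x" ..
        moreover have "i mod n \<in> {- \<bar>n\<bar>..\<bar>n\<bar>}" using abs_mod_less[OF n, of i] by auto
        ultimately show "z \<in> (\<lambda>i. sh i x) ` {- \<bar>n\<bar>..\<bar>n\<bar>}" by blast
      qed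
      then have fin: "finite Y" by (rule finite_subset) simp
      have "Y \<subseteq> X" using x by (auto simp: Y_def)
      then have "closedin T Y" using fin closedin_Hausdorff_finite[OF Hausdorff_T] by simp
      moreover have "seq_shift ` Y = Y"
      proof -
        have "sh i x \<in> sh 1 ` Y" for i
          by (rule image_eqI[of _ _ "sh (i - 1) x"]) (auto simp: Y_def)
        then show ?thesis by (auto simp: seq_shift_eq_sh Y_def)
      qed
      ultimately have "Y = {} \<or> Y = X" using assms(2) by (simp add: minimal_subshift_def)
      moreover have "Y \<noteq> {}" by (simp add: Y_def)
      ultimately show False using fin inf by simp
    qed
  qed
  show ?thesis
    unfolding commutator_subgroup_eq by (rule not_finitely_presented_DGr)
qed

end
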